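(* Let $\mathcal{X}$ be a finite set, $\mu$ a probability measure on $\mathcal{X}$, and for each $n$ let $p_n:\mathcal{X}\times\mathcal{X}\to[0,1]$ be a symmetric function such that $n\,p_n(a,b)\to C(a,b)$ for all $a,b\in\mathcal{X}$, where $C:\mathcal{X}\times\mathcal{X}\to[0,\infty)$ is symmetric and not identically zero. Let $X$ be the colored random graph on $n$ vertices with color law $\mu$ and connection probabilities $p_n$, with empirical color measure $L^1$ and empirical pair measure $L^2$. (a) Suppose the sequence $\omega_n\in\mathcal{M}_n(\mathcal{X})$ converges to a limit $\omega\in\mathcal{M}(\mathcal{X})$. Then, as $n\to\infty$, conditional on the event $\{L^1=\omega_n\}$, the empirical pair measure $L^2$ of $X$ satisfies a large deviation principle on the space $\tilde{\mathcal{M}}_*(\mathcal{X}\times\mathcal{X})$ with good rate function $$I_\omega(\varpi)=\tfrac12\,\mathfrak{H}_C(\varpi\,\|\,\omega).$$ (b) As $n\to\infty$, the pair $(L^1,L^2)$ satisfies a large deviation principle in $\mathcal{M}(\mathcal{X})\times\tilde{\mathcal{M}}_*(\mathcal{X}\times\mathcal{X})$ with good rate function $$I(\omega,\varpi)=H(\omega\,\|\,\mu)+\tfrac12\,\mathfrak{H}_C(\varpi\,\|\,\omega).$$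
   Context: $\mathcal{M}(\mathcal{X})$ is the space of probability measures on $\mathcal{X}$, $\tilde{\mathcal{M}}_*(\mathcal{X}\times\mathcal{X})$ the space of symmetric finite measures on $\mathcal{X}\times\mathcal{X}$, both with the weak topology; $\|\cdot\|$ is total mass. $\mathcal{M}_n(\mathcal{X})=\{\omega\in\mathcal{M}(\mathcal{X}): n\omega(a)\in\mathbb{N}\cup\{0\}\text{ for all }a\in\mathcal{X}\}$. For finite measures, $H(\nu\|\mu)=\sum_y\nu(y)\log(\nu(y)/\mu(y))$ if $\nu\ll\mu$ and $\infty$ otherwise. Colored random graph. The vertex set is $V=\{1,\dots,n\}$. Each vertex $v$ independently gets a color $X(v)$ with law $\mu$; given the colors, each pair of distinct vertices $u,v$ is connected by an edge, independently of everything else, with probability $p_n(X(u),X(v))$. The edge set is $E\subset\{(u,v)\in V\times V:u<v\}$ (simple unoriented graph). The empirical color measure is $L^1(a)=\frac1n\sum_{v\in V}\delta_{X(v)}(a)$, and the empirical pair measure is $L^2(a,b)=\frac1n\sum_{(u,v)\in E}[\delta_{(X(v),X(u))}+\delta_{(X(u),X(v))}](a,b)$. For $\varpi\in\tilde{\mathcal{M}}_*(\mathcal{X}\times\mathcal{X})$ and $\omega\in\mathcal{M}(\mathcal{X})$, $C\omega\otimes\omega(a,b)=C(a,b)\omega(a)\omega(b)$ and $\mathfrak{H}_C(\varpi\|\omega):=H(\varpi\|C\omega\otimes\omega)+\|C\omega\otimes\omega\|-\|\varpi\|$. In (a), it is understood that the conditioning events have positive probability. A rate function on a Polish space $\mathcal{S}$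 is a nonconstant lower semicontinuous $I:\mathcal{S}\to[0,\infty]$; it is good if all level sets $\{I\le x\}$, $x\in[0,\infty)$, are compact. $\mathcal{S}$-valued random variables $Z_n$ under laws $\mathbb{P}_n$ satisfy a large deviation principle with rate function $I$ if for all Borel $B\subset\mathcal{S}$: $-\inf_{\mathrm{int}\,B}I\le\liminf_n\frac1n\log\mathbb{P}_n\{Z_n\in B\}\le\limsup_n\frac1n\log\mathbb{P}_n\{Z_n\in B\}\le-\inf_{\mathrm{cl}\,B}I$. *)

theory Defs
  imports "HOL-Probability.Probability"
begin

(* A finite measure on a finite type is represented by its mass function. *)

definition prob_measures :: "('x::finite \<Rightarrow> real) set" where
  "prob_measures = {\<omega>. (\<forall>x. 0 \<le> \<omega> x) \<and> (\<Sum>x\<in>UNIV. \<omega> x) = 1}"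

definition sym_finite_measures :: "('x::finite \<times> 'x \<Rightarrow> real) set" where
  "sym_finite_measures = {\<pi>. (\<forall>x. 0 \<le> \<pi> x) \<and> (\<forall>a b. \<pi> (a, b) = \<pi> (b, a))}"

definition lattice_measures :: "nat \<Rightarrow> ('x::finite \<Rightarrow> real) set" where
  "lattice_measures n = {\<omega> \<in> prob_measures. \<forall>a. real n * \<omega> a \<in> \<nat>}"

definition total_mass :: "('x::finite \<Rightarrow> real) \<Rightarrow> real" where
  "total_mass \<nu> = (\<Sum>x\<in>UNIV. \<nu> x)"

(* The coarsest topology on M for which all integrals against test functions f are
   continuous; the codomain carries the product topology over all f. On a finite
   (discrete) space every real function is bounded and continuous. *)
definition weak_topology :: "('x::finite \<Rightarrow> real) set \<Rightarrow> ('x \<Rightarrow> real) topology" where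
  "weak_topology M =
     pullback_topology M (\<lambda>\<nu> (f::'x \<Rightarrow> real). \<Sum>x\<in>UNIV. f x * \<nu> x) euclidean"

(* Summands with \<nu> y = 0 vanish, as under the convention 0 log 0 = 0. *)
definition rel_entropy :: "('x::finite \<Rightarrow> real) \<Rightarrow> ('x \<Rightarrow> real) \<Rightarrow> ereal" where
  "rel_entropy \<nu> \<mu> =
     (if \<forall>y. \<mu> y = 0 \<longrightarrow> \<nu> y = 0
      then ereal (\<Sum>y\<in>UNIV. \<nu> y * ln (\<nu> y / \<mu> y)) else \<infinity>)"

definition weighted_square ::
    "('a \<Rightarrow> 'a \<Rightarrow> real) \<Rightarrow> ('a \<Rightarrow> real) \<Rightarrow> 'a \<times> 'a \<Rightarrow> real" where
  "weighted_square C \<omega> = (\<lambda>(a, b). C a b * \<omega> a * \<omega> b)"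

definition frak_H ::
    "('a::finite \<Rightarrow> 'a \<Rightarrow> real) \<Rightarrow> ('a \<times> 'a \<Rightarrow> real) \<Rightarrow> ('a \<Rightarrow> real) \<Rightarrow> ereal" where
  "frak_H C \<pi> \<omega> = rel_entropy \<pi> (weighted_square C \<omega>)
     + ereal (total_mass (weighted_square C \<omega>)) - ereal (total_mass \<pi>)"


definition vertex_pairs :: "nat \<Rightarrow> (nat \<times> nat) set" where
  "vertex_pairs n = {(u, v). u \<in> {1..n} \<and> v \<in> {1..n} \<and> u < v}"

(* Joint law of the colouring X and the edge set E; \<open>undefined\<close> and \<open>False\<close> are the values
   outside the vertex set and outside the set of vertex pairs. Given X, the edge
   indicators are independent. *)
definition colored_graph ::
    "'a pmf \<Rightarrow> ('a \<Rightarrow> 'a \<Rightarrow> real) \<Rightarrow> nat \<Rightarrow> ((nat \<Rightarrow> 'a) \<times> (nat \<times> nat) set) pmf" where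
  "colored_graph \<mu> p n =
     bind_pmf (Pi_pmf {1..n} undefined (\<lambda>_. \<mu>)) (\<lambda>X.
     bind_pmf (Pi_pmf (vertex_pairs n) False (\<lambda>(u, v). bernoulli_pmf (p (X u) (X v)))) (\<lambda>e.
     return_pmf (X, {uv. e uv})))"

definition emp_color :: "nat \<Rightarrow> (nat \<Rightarrow> 'a) \<times> (nat \<times> nat) set \<Rightarrow> 'a \<Rightarrow> real" where
  "emp_color n = (\<lambda>(X, E) a. 1 / real n * (\<Sum>v\<in>{1..n}. of_bool (X v = a)))"

definition emp_pair ::
    "nat \<Rightarrow> (nat \<Rightarrow> 'a) \<times> (nat \<times> nat) set \<Rightarrow> 'a \<times> 'a \<Rightarrow> real" where
  "emp_pair n = (\<lambda>(X, E) ab. 1 / real n *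
     (\<Sum>(u, v)\<in>E. of_bool ((X v, X u) = ab) + of_bool ((X u, X v) = ab)))"


definition lower_semicont :: "'s topology \<Rightarrow> ('s \<Rightarrow> ereal) \<Rightarrow> bool" where
  "lower_semicont T I \<longleftrightarrow> (\<forall>c. openin T {z \<in> topspace T. c < I z})"

definition rate_function :: "'s topology \<Rightarrow> ('s \<Rightarrow> ereal) \<Rightarrow> bool" where
  "rate_function T I \<longleftrightarrow>
     (\<forall>z\<in>topspace T. 0 \<le> I z) \<and>
     (\<exists>y\<in>topspace T. \<exists>z\<in>topspace T. I y \<noteq> I z) \<and>
     lower_semicont T I"

definition good_rate_function :: "'s topology \<Rightarrow> ('s \<Rightarrow> ereal) \<Rightarrow> bool" where
  "good_rate_function T I \<longleftrightarrow> rate_function T I \<and>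
     (\<forall>x::real. 0 \<le> x \<longrightarrow> compactin T {z \<in> topspace T. I z \<le> ereal x})"

(* Needed because \<open>ln 0 = 0\<close> on the reals. *)
definition log_prob :: "real \<Rightarrow> ereal" where
  "log_prob q = (if q = 0 then - \<infinity> else ereal (ln q))"

definition borel_of :: "'s topology \<Rightarrow> 's measure" where
  "borel_of T = sigma (topspace T) {U. openin T U}"

(* The sequence is indexed by n = 1, 2, ...; the value at 0 is irrelevant. *)
definition satisfies_LDP ::
    "'s topology \<Rightarrow> (nat \<Rightarrow> 'o measure) \<Rightarrow> (nat \<Rightarrow> 'o \<Rightarrow> 's) \<Rightarrow> ('s \<Rightarrow> ereal) \<Rightarrow> bool" where
  "satisfies_LDP T P Z I \<longleftrightarrow>
     (\<forall>n\<ge>1. prob_space (P n) \<and> Z n \<in> measurable (P n) (borel_of T)) \<and>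
     rate_function T I \<and>
     (\<forall>B\<in>sets (borel_of T).
        let r = (\<lambda>n. ereal (1 / real n) *
                       log_prob (measure (P n) {x \<in> space (P n). Z n x \<in> B}))
        in - (INF z \<in> T interior_of B. I z) \<le> liminf r \<and>
           liminf r \<le> limsup r \<and>
           limsup r \<le> - (INF z \<in> T closure_of B. I z))"

end

theory Submission
  imports Defs "HOL-Real_Asymp.Real_Asymp"
begin

text \<open>Both large deviation principles come from exponential tilting.  For a color function f with
\<open>\<Sum>a. \<mu> a * exp (f a) = 1\<close> and a symmetric function g on pairs of colors, recolor the vertices with
law \<open>\<mu> exp f\<close> and multiply the odds of every edge by \<open>exp g\<close>.  The result is again a colored random graph,
and its density with respect to the original one is, up to a factor \<open>exp (o(n))\<close> that is uniform in the
graph, the exponential of n times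

  \<open>L (f, g) (\<omega>, \<pi>) = \<Sum>a. f a * \<omega> a + 1/2 * \<Sum>y. (g y * \<pi> y - C\<omega>\<otimes>\<omega> y * (exp (g y) - 1))\<close>

evaluated at the pair \<open>(\<omega>, \<pi>)\<close> of empirical measures (lemma \<open>graph_density\<close>).  Indeed the density is an
explicit product over vertices and vertex pairs.  The tilts contribute integrals against the empirical
measures, and the logarithm of the edge normalizer is a sum over vertex pairs of a function of the two
colors, which is up to a bounded diagonal term a quadratic function of the empirical color measure.

The rate function is the supremum of all the L (f, g): each summand is a Legendre transform, with the
scalar inequality \<open>t * x - l * (exp t - 1) \<le> x * ln (x / l) - x + l\<close> behind it.  Equality holds in that
inequality only for \<open>x = l * exp t\<close>, so L (f, g) touches the rate function only at the tilted point
\<open>\<omega> = \<mu> exp f\<close>, \<open>\<pi> = C\<omega>\<otimes>\<omega> exp g\<close>.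

These facts suffice, as the locale \<open>tilted_family\<close> shows.  Markov's inequality for the densities together
with a finite cover of a compact set gives the upper bound for closed sets.  The same upper bound, applied
to a tilted law instead of the original one, shows that the tilted law concentrates at its tilted point,
because there alone no other L (f', g') exceeds L (f, g).  Changing back to the original law gives the
lower bound near tilted points, and these are dense enough: every point of finite rate is a limit of
tilted points along which the rate converges (lemmas \<open>color_sequence\<close> and \<open>pair_sequence\<close>).

For the conditional statement the colors are not tilted.  Conditioning on the empirical color measure then
changes the original and the tilted law by the same factor, since both have the same colors, so the density
estimate survives the conditioning and the same argument applies with \<open>\<omega>\<close> held fixed.
\<close>

section \<open>Large deviations from exponential tilting\<close>

lemma prob_le_of_pmf_le:
  assumes K: "0 \<le> K" and le: "\<And>x. x \<in> A \<Longrightarrow> pmf R x \<le> K * pmf Q x"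
  shows "measure_pmf.prob R A \<le> K * measure_pmf.prob Q A"
proof -
  have "emeasure (measure_pmf R) A = (\<integral>\<^sup>+x. ennreal (pmf R x) \<partial>count_space A)"
    by (simp add: nn_integral_pmf)
  also have "\<dots> \<le> (\<integral>\<^sup>+x. ennreal K * ennreal (pmf Q x) \<partial>count_space A)"
    using le K by (intro nn_integral_mono) (simp add: ennreal_mult[symmetric] ennreal_leI)
  also have "\<dots> = ennreal K * emeasure (measure_pmf Q) A"
    by (simp add: nn_integral_cmult nn_integral_pmf)
  finally show ?thesis
    using K by (simp add: measure_pmf.emeasure_eq_measure ennreal_mult[symmetric])
qed

text \<open>The strict inequality leaves room to absorb the number of sets in a finite union into the exponent.\<close>
definition decays_faster :: "(nat \<Rightarrow> 'o pmf) \<Rightarrow> (nat \<Rightarrow> 'o set) \<Rightarrow> real \<Rightarrow> bool" where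
  "decays_faster R A c \<longleftrightarrow>
     (\<exists>d>c. \<forall>\<^sub>F n in sequentially. measure_pmf.prob (R n) (A n) \<le> exp (- (real n * d)))"

lemma decays_faster_mono:
  assumes "decays_faster R A c" "\<And>n x. n \<ge> 1 \<Longrightarrow> x \<in> B n \<Longrightarrow> x \<in> A n"
  shows "decays_faster R B c"
proof -
  obtain d where d: "d > c"
      "\<forall>\<^sub>F n in sequentially. measure_pmf.prob (R n) (A n) \<le> exp (- (real n * d))"
    using assms(1) by (auto simp: decays_faster_def)
  have "\<forall>\<^sub>F n in sequentially. measure_pmf.prob (R n) (B n) \<le> exp (- (real n * d))"
    using d(2) eventually_ge_at_top[of 1]
  proof eventually_elim
    case (elim n)
    have "measure_pmf.prob (R n) (B n) \<le> measure_pmf.prob (R n) (A n)"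
      using assms(2) elim(2) by (intro measure_pmf.finite_measure_mono) auto
    then show ?case using elim(1) by linarith
  qed
  then show ?thesis using d(1) by (auto simp: decays_faster_def)
qed

lemma decays_faster_Un:
  assumes "decays_faster R A c" "decays_faster R B c"
  shows "decays_faster R (\<lambda>n. A n \<union> B n) c"
proof -
  obtain d1 where d1: "d1 > c"
      "\<forall>\<^sub>F n in sequentially. measure_pmf.prob (R n) (A n) \<le> exp (- (real n * d1))"
    using assms(1) by (auto simp: decays_faster_def)
  obtain d2 where d2: "d2 > c"
      "\<forall>\<^sub>F n in sequentially. measure_pmf.prob (R n) (B n) \<le> exp (- (real n * d2))"
    using assms(2) by (auto simp: decays_faster_def)
  define d where "d = min d1 d2"
  \<comment> \<open>an exponent strictly between, so that \<open>exp (n * (d - e))\<close> outgrows the factor 2 of the union bound\<close>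
  define e where "e = (c + d) / 2"
  have ce: "c < e" "e < d" using d1(1) d2(1) by (auto simp: d_def e_def min_def)
  have "(\<lambda>n. 2 * exp (- (real n * (d - e)))) \<longlonglongrightarrow> 0"
    using ce by real_asymp
  then have "\<forall>\<^sub>F n in sequentially. 2 * exp (- (real n * (d - e))) < 1"
    by (rule order_tendstoD) simp
  with d1(2) d2(2)
  have "\<forall>\<^sub>F n in sequentially. measure_pmf.prob (R n) (A n \<union> B n) \<le> exp (- (real n * e))"
  proof eventually_elim
    case (elim n)
    have 1: "exp (- (real n * d1)) \<le> exp (- (real n * d))" "exp (- (real n * d2)) \<le> exp (- (real n * d))"
      by (auto simp: d_def mult_left_mono)
    have "measure_pmf.prob (R n) (A n \<union> B n) \<le> measure_pmf.prob (R n) (A n) + measure_pmf.prob (R n) (B n)"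
      by (rule measure_Un_le) auto
    also have "\<dots> \<le> 2 * exp (- (real n * d))" using elim(1,2) 1 by linarith
    also have "\<dots> = (2 * exp (- (real n * (d - e)))) * exp (- (real n * e))"
      by (simp add: exp_add[symmetric] algebra_simps)
    also have "\<dots> \<le> 1 * exp (- (real n * e))"
      using elim(3) by (intro mult_right_mono) auto
    finally show ?case by simp
  qed
  then show ?thesis using ce(1) by (auto simp: decays_faster_def)
qed

lemma decays_faster_UN:
  assumes "finite S" "\<And>s. s \<in> S \<Longrightarrow> decays_faster R (A s) c"
  shows "decays_faster R (\<lambda>n. \<Union>s\<in>S. A s n) c"
  using assms
proof (induction S rule: finite_induct)
  case empty
  have "decays_faster R (\<lambda>n. {}) c"
    unfolding decays_faster_def by (intro exI[of _ "c + 1"]) simp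
  then show ?case by simp
next
  case (insert s S)
  have "decays_faster R (\<lambda>n. A s n \<union> (\<Union>s\<in>S. A s n)) c"
    by (intro decays_faster_Un insert) (use insert in auto)
  then show ?case by simp
qed

text \<open>Markov's inequality for the density of Q with respect to R: on the set where J exceeds d this density is
at least \<open>exp (n * (d - \<epsilon>))\<close>, while Q has mass at most one.\<close>
lemma decays_faster_exceedance:
  assumes dens: "\<And>\<epsilon>. \<epsilon> > 0 \<Longrightarrow> \<forall>\<^sub>F n in sequentially. \<forall>x.
      exp (real n * (J n x - \<epsilon>)) * pmf (R n) x \<le> pmf (Q n) x"
    and "c < d"
  shows "decays_faster R (\<lambda>n. {x. J n x > d}) c"
proof -
  define \<epsilon> where "\<epsilon> = (d - c) / 2"
  have \<epsilon>: "\<epsilon> > 0" "c < d - \<epsilon>" using \<open>c < d\<close> by (auto simp: \<epsilon>_def field_simps)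
  have "\<forall>\<^sub>F n in sequentially. measure_pmf.prob (R n) {x. J n x > d} \<le> exp (- (real n * (d - \<epsilon>)))"
    using dens[OF \<epsilon>(1)]
  proof eventually_elim
    case (elim n)
    have "measure_pmf.prob (R n) {x. J n x > d}
        \<le> exp (- (real n * (d - \<epsilon>))) * measure_pmf.prob (Q n) {x. J n x > d}"
    proof (rule prob_le_of_pmf_le)
      fix x assume x: "x \<in> {x. J n x > d}"
      have "pmf (R n) x = exp (- (real n * (d - \<epsilon>))) * (exp (real n * (d - \<epsilon>)) * pmf (R n) x)"
        by (simp add: exp_add[symmetric] flip: mult.assoc)
      also have "\<dots> \<le> exp (- (real n * (d - \<epsilon>))) * (exp (real n * (J n x - \<epsilon>)) * pmf (R n) x)"
        using x by (intro mult_left_mono mult_right_mono) (auto intro!: mult_left_mono)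
      also have "\<dots> \<le> exp (- (real n * (d - \<epsilon>))) * pmf (Q n) x"
        using elim by (intro mult_left_mono) auto
      finally show "pmf (R n) x \<le> exp (- (real n * (d - \<epsilon>))) * pmf (Q n) x" .
    qed simp
    also have "\<dots> \<le> exp (- (real n * (d - \<epsilon>)))"
      using mult_left_mono[OF measure_pmf.prob_le_1[of "Q n" "{x. J n x > d}"], of "exp (- (real n * (d - \<epsilon>)))"]
      by simp
    finally show ?case .
  qed
  then show ?thesis using \<epsilon>(2) by (auto simp: decays_faster_def)
qed

text \<open>The part of F where a coercive \<open>J s\<close> is large is handled by one exceedance event.  The rest of F is
compact, and finitely many exceedance events with levels strictly above c cover it.\<close>
lemma closed_set_decay:
  fixes T :: "'s topology"
  assumes cont: "\<And>s. s \<in> S \<Longrightarrow> continuous_map T euclideanreal (J s)"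
    and Z: "\<And>n x. n \<ge> 1 \<Longrightarrow> Z n x \<in> topspace T"
    and dens: "\<And>s \<epsilon>. s \<in> S \<Longrightarrow> \<epsilon> > 0 \<Longrightarrow> \<forall>\<^sub>F n in sequentially. \<forall>x.
      exp (real n * (J s (Z n x) - \<epsilon>)) * pmf (R n) x \<le> pmf (Q s n) x"
    and tight: "\<exists>s\<in>S. \<forall>r. compactin T {z \<in> topspace T. J s z \<le> r}"
    and F: "closedin T F"
    and big: "\<And>z. z \<in> F \<Longrightarrow> \<exists>s\<in>S. c < J s z"
  shows "decays_faster R (\<lambda>n. {x. Z n x \<in> F}) c"
proof -
  define W where "W = (\<lambda>(s, d). {z \<in> topspace T. d < J s z})"
  have openW: "openin T (W (s, d))" if "s \<in> S" for s d
  proof -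
    have "openin T {z \<in> topspace T. J s z \<in> {d<..}}"
      by (rule openin_continuous_map_preimage[OF cont[OF that]]) (simp add: open_greaterThan)
    then show ?thesis by (simp add: W_def)
  qed
  obtain s0 where s0: "s0 \<in> S" "\<And>r. compactin T {z \<in> topspace T. J s0 z \<le> r}"
    using tight by blast
  \<comment> \<open>any level above c would do in place of \<open>c + 1\<close>\<close>
  define K where "K = {z \<in> topspace T. J s0 z \<le> c + 1} \<inter> F"
  have K: "compactin T K"
    unfolding K_def using s0(2) F by (intro compact_Int_closedin)
  have cover: "K \<subseteq> \<Union> (W ` (S \<times> {c<..}))"
  proof
    fix z assume z: "z \<in> K"
    then obtain s where "s \<in> S" "c < J s z" using big by (auto simp: K_def)
    moreover obtain d where "c < d" "d < J s z" using dense[OF \<open>c < J s z\<close>] by blast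
    ultimately show "z \<in> \<Union> (W ` (S \<times> {c<..}))"
      using z by (auto simp: W_def K_def)
  qed
  have op: "\<forall>U\<in>W ` (S \<times> {c<..}). openin T U" using openW by auto
  obtain \<F> where \<F>: "finite \<F>" "\<F> \<subseteq> W ` (S \<times> {c<..})" "K \<subseteq> \<Union>\<F>"
    using K op cover unfolding compactin_def by meson
  obtain G where G: "finite G" "G \<subseteq> S \<times> {c<..}" "\<F> = W ` G"
    using finite_subset_image[OF \<F>(1,2)] by blast
  have "decays_faster R (\<lambda>n. \<Union>t\<in>insert (s0, c + 1) G. {x. Z n x \<in> W t}) c"
  proof (rule decays_faster_UN)
    fix t assume "t \<in> insert (s0, c + 1) G"
    then obtain s d where t: "t = (s, d)" "s \<in> S" "c < d" using G(2) s0(1) by auto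
    have "decays_faster R (\<lambda>n. {x. J s (Z n x) > d}) c"
      by (rule decays_faster_exceedance[OF dens[OF t(2)] t(3)])
    then show "decays_faster R (\<lambda>n. {x. Z n x \<in> W t}) c"
      by (rule decays_faster_mono) (auto simp: W_def t)
  qed (use G in auto)
  then show ?thesis
  proof (rule decays_faster_mono)
    fix n x assume "n \<ge> (1::nat)" and x: "x \<in> {x. Z n x \<in> F}"
    then have T: "Z n x \<in> topspace T" using Z by auto
    show "x \<in> (\<Union>t\<in>insert (s0, c + 1) G. {x. Z n x \<in> W t})"
    proof (cases "J s0 (Z n x) \<le> c + 1")
      case True
      then have "Z n x \<in> K" using T x by (auto simp: K_def)
      then show ?thesis using \<F>(3) G(3) by auto
    next
      case False
      then show ?thesis using T by (auto simp: W_def)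
    qed
  qed
qed

text \<open>The law \<open>Q s\<close> is the tilt of P with log-density \<open>n * L s (Z n)\<close> up to an error of order \<open>o(n)\<close>, and
\<open>peak s\<close> is the only point where \<open>L s\<close> can reach I.  The tightness assumption is the exponential tightness
of every tilted law; for the trivial tilt it makes one of the functions \<open>L s\<close> coercive.\<close>
locale tilted_family =
  fixes T :: "'s topology" and P :: "nat \<Rightarrow> 'o pmf" and Z :: "nat \<Rightarrow> 'o \<Rightarrow> 's"
    and I :: "'s \<Rightarrow> ereal" and S :: "'t set" and L :: "'t \<Rightarrow> 's \<Rightarrow> real"
    and Q :: "'t \<Rightarrow> nat \<Rightarrow> 'o pmf" and peak :: "'t \<Rightarrow> 's"
  assumes L_cont: "s \<in> S \<Longrightarrow> continuous_map T euclideanreal (L s)"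
    and Z_in: "n \<ge> 1 \<Longrightarrow> Z n x \<in> topspace T"
    and dens: "s \<in> S \<Longrightarrow> \<epsilon> > 0 \<Longrightarrow> \<forall>\<^sub>F n in sequentially. \<forall>x.
        exp (real n * (L s (Z n x) - \<epsilon>)) * pmf (P n) x \<le> pmf (Q s n) x \<and>
        pmf (Q s n) x \<le> exp (real n * (L s (Z n x) + \<epsilon>)) * pmf (P n) x"
    and L_zero: "\<exists>s\<in>S. \<forall>z\<in>topspace T. L s z = 0"
    and tight: "s \<in> S \<Longrightarrow> \<exists>s'\<in>S. \<forall>r. compactin T {z \<in> topspace T. L s' z - L s z \<le> r}"
    and L_le_I: "s \<in> S \<Longrightarrow> z \<in> topspace T \<Longrightarrow> ereal (L s z) \<le> I z"
    and L_less_I: "s \<in> S \<Longrightarrow> z \<in> topspace T \<Longrightarrow> z \<noteq> peak s \<Longrightarrow> ereal (L s z) < I z"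
    and approx: "z \<in> topspace T \<Longrightarrow> \<exists>\<sigma>. (\<forall>k. \<sigma> k \<in> S) \<and> (\<lambda>k. ereal (L (\<sigma> k) z)) \<longlonglongrightarrow> I z \<and>
        (I z < \<infinity> \<longrightarrow> limitin T (\<lambda>k. peak (\<sigma> k)) z sequentially \<and>
          (\<lambda>k. ereal (L (\<sigma> k) (peak (\<sigma> k)))) \<longlonglongrightarrow> I z)"
    and I_nonconst: "\<exists>y\<in>topspace T. \<exists>z\<in>topspace T. I y \<noteq> I z"
begin

lemma I_SUP:
  assumes z: "z \<in> topspace T"
  shows "I z = (SUP s\<in>S. ereal (L s z))"
proof (rule antisym)
  obtain \<sigma> where \<sigma>: "\<And>k. \<sigma> k \<in> S" "(\<lambda>k. ereal (L (\<sigma> k) z)) \<longlonglongrightarrow> I z"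
    using approx[OF z] by blast
  show "I z \<le> (SUP s\<in>S. ereal (L s z))"
    using \<sigma> by (intro LIMSEQ_le_const2[OF \<sigma>(2)]) (auto intro!: SUP_upper)
  show "(SUP s\<in>S. ereal (L s z)) \<le> I z"
    by (rule SUP_least) (rule L_le_I[OF _ z])
qed

text \<open>The peaks that approximate z serve as points y.  Every \<open>z' \<noteq> y\<close> has \<open>L s z' < I z'\<close>, and since I is a
supremum, some other \<open>L s'\<close> already exceeds \<open>L s\<close> at \<open>z'\<close>.\<close>
lemma exposed_dense:
  assumes z: "z \<in> topspace T" and fin: "I z < \<infinity>" and U: "openin T U" "z \<in> U" and \<epsilon>: "\<epsilon> > 0"
  shows "\<exists>s\<in>S. \<exists>y\<in>U. (\<forall>z'\<in>topspace T. z' \<noteq> y \<longrightarrow> (\<exists>s'\<in>S. L s z' < L s' z')) \<and>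
          ereal (L s y) \<le> I z + ereal \<epsilon>"
proof -
  obtain \<sigma> where \<sigma>: "\<And>k. \<sigma> k \<in> S" "limitin T (\<lambda>k. peak (\<sigma> k)) z sequentially"
      "(\<lambda>k. ereal (L (\<sigma> k) (peak (\<sigma> k)))) \<longlonglongrightarrow> I z"
    using approx[OF z] fin by blast
  have "I z < I z + ereal \<epsilon>" using fin \<epsilon> L_le_I[OF \<sigma>(1) z, of 0] by (cases "I z") auto
  with \<sigma>(3) have "\<forall>\<^sub>F k in sequentially. ereal (L (\<sigma> k) (peak (\<sigma> k))) < I z + ereal \<epsilon>"
    by (rule order_tendstoD)
  moreover have "\<forall>\<^sub>F k in sequentially. peak (\<sigma> k) \<in> U"
    using \<sigma>(2) U by (auto simp: limitin_def)
  ultimately have "\<forall>\<^sub>F k in sequentially. peak (\<sigma> k) \<in> U \<and> ereal (L (\<sigma> k) (peak (\<sigma> k))) < I z + ereal \<epsilon>"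
    by eventually_elim auto
  then obtain k where k: "peak (\<sigma> k) \<in> U" "ereal (L (\<sigma> k) (peak (\<sigma> k))) < I z + ereal \<epsilon>"
    by (auto simp: eventually_sequentially)
  have "\<exists>s'\<in>S. L (\<sigma> k) z' < L s' z'" if "z' \<in> topspace T" "z' \<noteq> peak (\<sigma> k)" for z'
    using L_less_I[OF \<sigma>(1) that] unfolding I_SUP[OF that(1)] less_SUP_iff by simp
  then show ?thesis using k \<sigma>(1)[of k] by (metis order_less_imp_le)
qed

lemma I_nonneg: "z \<in> topspace T \<Longrightarrow> 0 \<le> I z"
proof -
  assume z: "z \<in> topspace T"
  obtain s where "s \<in> S" "L s z = 0" using L_zero z by blast
  then have "ereal 0 \<le> (SUP s\<in>S. ereal (L s z))" by (metis SUP_upper)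
  then show ?thesis using I_SUP[OF z] by (simp add: zero_ereal_def)
qed

lemma coercive: "\<exists>s\<in>S. \<forall>r. compactin T {z \<in> topspace T. L s z \<le> r}"
proof -
  obtain s where s: "s \<in> S" "\<forall>z\<in>topspace T. L s z = 0" using L_zero by blast
  obtain s' where s': "s' \<in> S" "\<forall>r. compactin T {z \<in> topspace T. L s' z - L s z \<le> r}"
    using tight[OF s(1)] by blast
  have "{z \<in> topspace T. L s' z - L s z \<le> r} = {z \<in> topspace T. L s' z \<le> r}" for r
    using s(2) by auto
  then show ?thesis using s' by auto
qed

text \<open>I is a supremum of continuous functions, hence lower semicontinuous, and its level sets are closed
subsets of the compact level sets of a single coercive \<open>L s\<close>.\<close>
lemma good_rate: "good_rate_function T I"
proof -
  have lsc: "openin T {z \<in> topspace T. c < I z}" for c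
  proof -
    have "{z \<in> topspace T. c < I z} = (\<Union>s\<in>S. {z \<in> topspace T. L s z \<in> {x. c < ereal x}})"
      by (auto simp: I_SUP less_SUP_iff)
    moreover have "openin T {z \<in> topspace T. L s z \<in> {x. c < ereal x}}" if "s \<in> S" for s
    proof (rule openin_continuous_map_preimage[OF L_cont[OF that]])
      have "{x. c < ereal x} = (case c of ereal r \<Rightarrow> {r<..} | PInfty \<Rightarrow> {} | MInfty \<Rightarrow> UNIV)"
        by (cases c) auto
      then show "openin euclideanreal {x. c < ereal x}"
        by (cases c) (auto simp: open_greaterThan)
    qed
    ultimately show ?thesis by auto
  qed
  moreover have "compactin T {z \<in> topspace T. I z \<le> ereal r}" for r
  proof -
    obtain s where s: "s \<in> S" "\<forall>r. compactin T {z \<in> topspace T. L s z \<le> r}"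
      using coercive by blast
    have "{z \<in> topspace T. I z \<le> ereal r} = topspace T - {z \<in> topspace T. ereal r < I z}"
      by auto
    then have "closedin T {z \<in> topspace T. I z \<le> ereal r}" using lsc by (metis closedin_diff closedin_topspace)
    moreover have "{z \<in> topspace T. I z \<le> ereal r} \<subseteq> {z \<in> topspace T. L s z \<le> r}"
    proof clarsimp
      fix z assume z: "z \<in> topspace T" "I z \<le> ereal r"
      have "ereal (L s z) \<le> I z" using I_SUP[OF z(1)] s(1) by (metis SUP_upper)
      then show "L s z \<le> r" using z(2) by (metis ereal_less_eq(3) order_trans)
    qed
    ultimately show ?thesis using s(2) closed_compactin by meson
  qed
  ultimately show ?thesis
    using I_nonneg I_nonconst
    by (auto simp: good_rate_function_def rate_function_def lower_semicont_def)
qed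

lemma upper_bound:
  assumes F: "closedin T F" and "B \<subseteq> F"
  shows "limsup (\<lambda>n. ereal (1 / real n) * log_prob (measure_pmf.prob (P n) {x. Z n x \<in> B}))
      \<le> - (INF z\<in>F. I z)"
proof (rule ereal_le_real)
  have FT: "F \<subseteq> topspace T" using F by (rule closedin_subset)
  fix r :: real assume "- (INF z\<in>F. I z) \<le> ereal r"
  then have r: "ereal (- r) \<le> (INF z\<in>F. I z)" 
    by (subst (asm) ereal_uminus_le_reorder) simp
  show "limsup (\<lambda>n. ereal (1 / real n) * log_prob (measure_pmf.prob (P n) {x. Z n x \<in> B})) \<le> ereal r"
  proof (rule ereal_le_epsilon2)
    fix e :: real assume e: "e > 0"
    have exceed: "\<exists>s\<in>S. - r - e < L s z" if "z \<in> F" for z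
    proof -
      have "ereal (- r - e) < ereal (- r)" using e by simp
      also have "\<dots> \<le> I z" using r that by (meson INF_lower order_trans)
      finally show ?thesis using I_SUP[of z] that FT by (auto simp: less_SUP_iff)
    qed
    have "decays_faster P (\<lambda>n. {x. Z n x \<in> F}) (- r - e)"
    proof (rule closed_set_decay[where J = L and Z = Z and S = S and Q = Q])
      show "\<exists>s\<in>S. \<forall>r. compactin T {z \<in> topspace T. L s z \<le> r}" by (rule coercive)
      fix s and \<epsilon> :: real assume "s \<in> S" "\<epsilon> > 0"
      from dens[OF this]
      show "\<forall>\<^sub>F n in sequentially. \<forall>x.
          exp (real n * (L s (Z n x) - \<epsilon>)) * pmf (P n) x \<le> pmf (Q s n) x"
        by (rule eventually_mono) blast
    qed (fact F L_cont Z_in exceed)+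
    then have "decays_faster P (\<lambda>n. {x. Z n x \<in> B}) (- r - e)"
      by (rule decays_faster_mono) (use \<open>B \<subseteq> F\<close> in auto)
    then obtain d where d: "d > - r - e" 
       "\<forall>\<^sub>F n in sequentially. measure_pmf.prob (P n) {x. Z n x \<in> B} \<le> exp (- (real n * d))"
      by (auto simp: decays_faster_def)
    have "\<forall>\<^sub>F n in sequentially.
        ereal (1 / real n) * log_prob (measure_pmf.prob (P n) {x. Z n x \<in> B}) \<le> ereal (r + e)"
      using d(2) eventually_gt_at_top[of 0]
    proof eventually_elim
      case (elim n)
      define q where "q = measure_pmf.prob (P n) {x. Z n x \<in> B}"
      show ?case
      proof (cases "q = 0")
        case True
        then show ?thesis using elim(2) by (simp add: log_prob_def q_def)
      next
        case False
        then have "q > 0" by (simp add: q_def order_less_le)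
        then have "ln q \<le> - (real n * d)"
          using elim(1) ln_le_cancel_iff[of q "exp (- (real n * d))"] by (simp add: q_def)
        then have "ln q / real n \<le> - d" using elim(2) by (simp add: field_simps)
        then show ?thesis using False d(1) by (simp add: log_prob_def q_def)
      qed
    qed
    then show "limsup (\<lambda>n. ereal (1 / real n) * log_prob (measure_pmf.prob (P n) {x. Z n x \<in> B}))
         \<le> ereal r + ereal e"
      by (simp add: Limsup_bounded)
  qed
qed

text \<open>With respect to \<open>Q s\<close> the law \<open>Q s'\<close> has log-density \<open>n * (L s' - L s)\<close>.  Away from y one of these
differences is positive, so the complement of U decays exponentially by the estimate for closed sets.\<close>
lemma exposed_concentration:
  assumes s: "s \<in> S" and U: "openin T U" "y \<in> U"
    and y: "\<And>z. z \<in> topspace T \<Longrightarrow> z \<noteq> y \<Longrightarrow> \<exists>s'\<in>S. L s z < L s' z"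
  shows "\<forall>\<^sub>F n in sequentially. measure_pmf.prob (Q s n) {x. Z n x \<in> U} \<ge> 1 / 2"
proof -
  define J where "J s' z = L s' z - L s z" for s' z
  have "decays_faster (Q s) (\<lambda>n. {x. Z n x \<in> topspace T - U}) 0"
  proof (rule closed_set_decay[where J = J and Z = Z and S = S and Q = Q])
    show "continuous_map T euclideanreal (J s')" if "s' \<in> S" for s'
      unfolding J_def using L_cont s that by (intro continuous_map_diff) auto
    show "\<exists>s'\<in>S. \<forall>r. compactin T {z \<in> topspace T. J s' z \<le> r}"
      unfolding J_def by (rule tight[OF s])
    show "closedin T (topspace T - U)" using U by auto
    show "\<exists>s'\<in>S. 0 < J s' z" if "z \<in> topspace T - U" for z
    proof -
      have "z \<noteq> y" using that U by auto
      then show ?thesis using y[of z] that by (auto simp: J_def)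
    qed
    fix s' and \<epsilon> :: real assume s': "s' \<in> S" and \<epsilon>: "\<epsilon> > 0"
    have e2: "\<epsilon> / 2 > 0" using \<epsilon> by simp
    show "\<forall>\<^sub>F n in sequentially. \<forall>x.
        exp (real n * (J s' (Z n x) - \<epsilon>)) * pmf (Q s n) x \<le> pmf (Q s' n) x"
      using dens[OF s e2] dens[OF s' e2]
    proof eventually_elim
      case (elim n)
      show ?case
      proof
        fix x
        have "exp (real n * (J s' (Z n x) - \<epsilon>)) * pmf (Q s n) x
           \<le> exp (real n * (J s' (Z n x) - \<epsilon>)) * (exp (real n * (L s (Z n x) + \<epsilon> / 2)) * pmf (P n) x)"
          using elim(1) by (intro mult_left_mono) auto
        also have "\<dots> = exp (real n * (L s' (Z n x) - \<epsilon> / 2)) * pmf (P n) x"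
          by (simp add: J_def exp_add[symmetric] algebra_simps)
        also have "\<dots> \<le> pmf (Q s' n) x" using elim(2) by auto
        finally show "exp (real n * (J s' (Z n x) - \<epsilon>)) * pmf (Q s n) x \<le> pmf (Q s' n) x" .
      qed
    qed
  qed (use Z_in in auto)
  then obtain d where d: "d > 0" 
    "\<forall>\<^sub>F n in sequentially. measure_pmf.prob (Q s n) {x. Z n x \<in> topspace T - U} \<le> exp (- (real n * d))"
    by (auto simp: decays_faster_def)
  have "(\<lambda>n. exp (- (real n * d))) \<longlonglongrightarrow> 0" using d(1) by real_asymp
  then have "\<forall>\<^sub>F n in sequentially. exp (- (real n * d)) < 1 / 2" by (rule order_tendstoD) simp
  with d(2) show ?thesis using eventually_ge_at_top[of 1]
  proof eventually_elim
    case (elim n)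
    have "{x. Z n x \<in> topspace T - U} = UNIV - {x. Z n x \<in> U}"
      using Z_in[OF elim(3)] by auto
    then have "measure_pmf.prob (Q s n) {x. Z n x \<in> topspace T - U}
        = 1 - measure_pmf.prob (Q s n) {x. Z n x \<in> U}"
      using measure_pmf.prob_compl[of "{x. Z n x \<in> U}" "Q s n"] by simp
    then show ?case using elim by linarith
  qed
qed

text \<open>Under \<open>Q s\<close> a small neighborhood V of the exposed point y eventually has probability at least one half, and on V the
density with respect to P is at most \<open>exp (n * (L s y + 2 * \<epsilon>))\<close>.\<close>
lemma lower_bound:
  assumes U: "openin T U" and "U \<subseteq> B"
  shows "- (INF z\<in>U. I z) \<le>
     liminf (\<lambda>n. ereal (1 / real n) * log_prob (measure_pmf.prob (P n) {x. Z n x \<in> B}))"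
    (is "_ \<le> liminf ?r")
proof -
  have UT: "U \<subseteq> topspace T" using U by (rule openin_subset)
  have "- liminf ?r \<le> I z" if z: "z \<in> U" for z
  proof (cases "I z = \<infinity>")
    case False
    have zT: "z \<in> topspace T" using z UT by auto
    show ?thesis
    proof (rule ereal_le_epsilon2)
      fix e :: real assume e: "e > 0"
      define \<epsilon> where "\<epsilon> = e / 4"
      have \<epsilon>: "\<epsilon> > 0" using e by (simp add: \<epsilon>_def)
      obtain s y where sy: "s \<in> S" "y \<in> U"
        "\<And>z'. z' \<in> topspace T \<Longrightarrow> z' \<noteq> y \<Longrightarrow> \<exists>s'\<in>S. L s z' < L s' z'"
        "ereal (L s y) \<le> I z + ereal \<epsilon>"
        using exposed_dense[OF zT _ U z \<epsilon>] False by (auto simp: less_top[symmetric] top_ereal_def)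
      define V where "V = U \<inter> {z \<in> topspace T. L s z \<in> {..<L s y + \<epsilon>}}"
      have V: "openin T V" unfolding V_def
        using U by (intro openin_Int openin_continuous_map_preimage[OF L_cont[OF sy(1)]])
          (auto simp: open_lessThan)
      have yV: "y \<in> V" using sy(2) UT \<epsilon> by (auto simp: V_def)
      have "(\<lambda>n. ln (1 / 2) / real n) \<longlonglongrightarrow> 0" by real_asymp
      then have lim: "\<forall>\<^sub>F n in sequentially. ln (1 / 2) / real n > - \<epsilon>"
        by (rule order_tendstoD) (use \<epsilon> in simp)
      have "\<forall>\<^sub>F n in sequentially. measure_pmf.prob (Q s n) {x. Z n x \<in> V} \<ge> 1 / 2"
        using sy(3) by (intro exposed_concentration[OF sy(1) V yV]) auto
      then have "\<forall>\<^sub>F n in sequentially. ereal (- (L s y + 3 * \<epsilon>)) \<le> ?r n"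
        using dens[OF sy(1) \<epsilon>] lim
          eventually_gt_at_top[of 0]
      proof eventually_elim
        case (elim n)
        define K where "K = exp (real n * (L s y + 2 * \<epsilon>))"
        have "1 / 2 \<le> measure_pmf.prob (Q s n) {x. Z n x \<in> V}" using elim(1) .
        also have "\<dots> \<le> K * measure_pmf.prob (P n) {x. Z n x \<in> V}"
        proof (rule prob_le_of_pmf_le)
          fix x assume x: "x \<in> {x. Z n x \<in> V}"
          have "pmf (Q s n) x \<le> exp (real n * (L s (Z n x) + \<epsilon>)) * pmf (P n) x" using elim(2) by auto
          also have "\<dots> \<le> K * pmf (P n) x"
            unfolding K_def using x by (intro mult_right_mono) (auto simp: V_def intro!: mult_left_mono)
          finally show "pmf (Q s n) x \<le> K * pmf (P n) x" .
        qed (simp add: K_def)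
        also have "\<dots> \<le> K * measure_pmf.prob (P n) {x. Z n x \<in> B}"
          using \<open>U \<subseteq> B\<close> by (intro mult_left_mono measure_pmf.finite_measure_mono) (auto simp: V_def K_def)
        finally have ge: "1 / 2 \<le> K * measure_pmf.prob (P n) {x. Z n x \<in> B}" .
        define q where "q = measure_pmf.prob (P n) {x. Z n x \<in> B}"
        have "q \<noteq> 0" using ge by (auto simp: q_def)
        then have q: "q > 0" by (simp add: q_def order_less_le)
        have "ln (1 / 2) \<le> ln (K * q)" using ge by (simp add: q_def)
        also have "\<dots> = real n * (L s y + 2 * \<epsilon>) + ln q"
          using q by (subst ln_mult) (auto simp: K_def)
        finally have "ln (1 / 2) / real n \<le> (L s y + 2 * \<epsilon>) + ln q / real n"
          using elim(4) by (simp add: field_simps)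
        then have "- (L s y + 3 * \<epsilon>) \<le> ln q / real n" using elim(3) by linarith
        then show ?case using q by (simp add: log_prob_def q_def)
      qed
      then have "ereal (- (L s y + 3 * \<epsilon>)) \<le> liminf ?r" by (rule Liminf_bounded)
      then have "- liminf ?r \<le> ereal (L s y + 3 * \<epsilon>)"
        by (subst ereal_uminus_le_reorder) simp
      also have "\<dots> = ereal (L s y) + ereal (3 * \<epsilon>)" by simp
      also have "\<dots> \<le> (I z + ereal \<epsilon>) + ereal (3 * \<epsilon>)" using sy(4) by (intro add_right_mono)
      also have "\<dots> = I z + ereal e" by (simp add: \<epsilon>_def add.assoc)
      finally show "- liminf ?r \<le> I z + ereal e" .
    qed
  qed simp
  then have "- liminf ?r \<le> (INF z\<in>U. I z)" by (rule INF_greatest)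
  then show ?thesis by (subst ereal_uminus_le_reorder)
qed

theorem LDP: "satisfies_LDP T (\<lambda>n. measure_pmf (P n)) Z I"
  unfolding satisfies_LDP_def Let_def
proof (intro conjI allI ballI impI)
  have sp: "space (borel_of T) = topspace T" 
    unfolding borel_of_def by (rule space_measure_of) (auto dest: openin_subset)
  show "prob_space (measure_pmf (P n))" for n by (rule measure_pmf.prob_space_axioms)
  show "Z n \<in> measurable (measure_pmf (P n)) (borel_of T)" if "n \<ge> 1" for n
    using Z_in[OF that] sp by (auto simp: measurable_def)
  show "rate_function T I" using good_rate by (simp add: good_rate_function_def)
  fix B assume B: "B \<in> sets (borel_of T)"
  then have BT: "B \<subseteq> topspace T" using sets.sets_into_space sp by metis
  show "- (INF z\<in>T interior_of B. I z) \<le> liminf (\<lambda>n. ereal (1 / real n) *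
      log_prob (measure_pmf.prob (P n) {x \<in> space (measure_pmf (P n)). Z n x \<in> B}))"
    using lower_bound[OF openin_interior_of interior_of_subset] by simp
  show "limsup (\<lambda>n. ereal (1 / real n) *
      log_prob (measure_pmf.prob (P n) {x \<in> space (measure_pmf (P n)). Z n x \<in> B}))
     \<le> - (INF z\<in>T closure_of B. I z)"
    using upper_bound[OF closedin_closure_of closure_of_subset[OF BT]] by simp
qed (rule Liminf_le_Limsup, simp)

end

section \<open>The weak topology over a finite set\<close>

text \<open>Integration against test functions is continuous in the coordinates because the space is finite, and the
indicator functions of points recover the coordinates.\<close>
lemma weak_topology_eq_subtopology:
  "weak_topology (M :: ('x::finite \<Rightarrow> real) set) = top_of_set M"
proof (rule topology_eq[THEN iffD2], intro allI)
  fix S :: "('x \<Rightarrow> real) set"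
  define F :: "('x \<Rightarrow> real) \<Rightarrow> ('x \<Rightarrow> real) \<Rightarrow> real" where "F = (\<lambda>\<nu> f. \<Sum>x\<in>UNIV. f x * \<nu> x)"
  define G :: "(('x \<Rightarrow> real) \<Rightarrow> real) \<Rightarrow> 'x \<Rightarrow> real" where "G = (\<lambda>h x. h (\<lambda>y. of_bool (y = x)))"
  have contF: "continuous_on UNIV F"
    unfolding F_def
    by (intro continuous_on_coordinatewise_then_product continuous_on_sum continuous_on_mult
        continuous_on_const continuous_on_product_coordinates)
  have contG: "continuous_on UNIV G"
    unfolding G_def
    by (intro continuous_on_coordinatewise_then_product continuous_on_product_coordinates)
  have GF: "G (F \<nu>) = \<nu>" for \<nu>
  proof
    fix x
    have "(\<Sum>y\<in>UNIV. of_bool (y = x) * \<nu> y) = (\<Sum>y\<in>UNIV. if y = x then \<nu> y else 0)"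
      by (rule sum.cong) auto
    then show "G (F \<nu>) x = \<nu> x" by (simp add: G_def F_def)
  qed
  have "openin (weak_topology M) S \<longleftrightarrow> (\<exists>U. open U \<and> S = F -` U \<inter> M)"
    by (simp add: weak_topology_def openin_pullback_topology F_def)
  also have "\<dots> \<longleftrightarrow> (\<exists>V. open V \<and> S = M \<inter> V)"
  proof
    assume "\<exists>U. open U \<and> S = F -` U \<inter> M"
    then show "\<exists>V. open V \<and> S = M \<inter> V"
      using open_vimage[OF _ contF] by blast
  next
    assume "\<exists>V. open V \<and> S = M \<inter> V"
    then obtain V where V: "open V" "S = M \<inter> V" by blast
    then have "open (G -` V)" using open_vimage[OF _ contG] by blast
    moreover have "S = F -` (G -` V) \<inter> M" using V(2) GF by auto
    ultimately show "\<exists>U. open U \<and> S = F -` U \<inter> M" by blast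
  qed
  finally show "openin (weak_topology M) S \<longleftrightarrow> openin (top_of_set M) S"
    by (simp add: openin_open)
qed

lemma tendsto_fun_iff:
  fixes f :: "'b \<Rightarrow> 'x \<Rightarrow> 'c::topological_space"
  shows "(f \<longlongrightarrow> l) F \<longleftrightarrow> (\<forall>x. ((\<lambda>b. f b x) \<longlongrightarrow> l x) F)"
proof -
  have "(f \<longlongrightarrow> l) F \<longleftrightarrow> limitin (product_topology (\<lambda>_::'x. euclidean) UNIV) f l F"
    by (simp add: euclidean_product_topology)
  also have "\<dots> \<longleftrightarrow> (\<forall>x. ((\<lambda>b. f b x) \<longlongrightarrow> l x) F)"
    by (subst limitin_componentwise) auto
  finally show ?thesis .
qed

lemma compact_box: "compact {\<nu> :: 'x \<Rightarrow> real. \<forall>x. \<nu> x \<in> {0..m}}"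
proof -
  have "compactin (product_topology (\<lambda>_::'x. euclideanreal) UNIV) (\<Pi>\<^sub>E x\<in>UNIV. {0..m})"
    by (subst compactin_PiE) auto
  then show ?thesis
    by (simp add: euclidean_product_topology PiE_UNIV_domain Pi_def)
qed

lemma continuous_on_coord_fst [continuous_intros]:
  "continuous_on A (\<lambda>z :: ('x \<Rightarrow> real) \<times> 'b::topological_space. fst z x)"
  by (rule continuous_on_product_then_coordinatewise) (intro continuous_intros)

lemma continuous_on_coord_snd [continuous_intros]:
  "continuous_on A (\<lambda>z :: 'b::topological_space \<times> ('x \<Rightarrow> real). snd z x)"
  by (rule continuous_on_product_then_coordinatewise) (intro continuous_intros)

lemma closed_prob_measures: "closed (prob_measures :: ('x::finite \<Rightarrow> real) set)"
  unfolding prob_measures_def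
  by (intro closed_Collect_conj closed_Collect_all closed_Collect_le closed_Collect_eq
      continuous_on_sum continuous_on_const continuous_on_product_coordinates)

lemma closed_sym_finite_measures:
  "closed (sym_finite_measures :: ('x::finite \<times> 'x \<Rightarrow> real) set)"
  unfolding sym_finite_measures_def
  by (intro closed_Collect_conj closed_Collect_all closed_Collect_le closed_Collect_eq
      continuous_on_sum continuous_on_const continuous_on_product_coordinates)

lemma prob_measures_nonneg: "\<omega> \<in> prob_measures \<Longrightarrow> 0 \<le> \<omega> x"
  by (simp add: prob_measures_def)

lemma prob_measures_le_1: "\<omega> \<in> prob_measures \<Longrightarrow> \<omega> x \<le> 1"
  unfolding prob_measures_def
  using member_le_sum[of x UNIV \<omega>] by auto

lemma sym_finite_measures_nonneg: "\<pi> \<in> sym_finite_measures \<Longrightarrow> 0 \<le> \<pi> y"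
  by (cases y) (simp add: sym_finite_measures_def)

lemma weighted_square_apply:
  "weighted_square C \<omega> y = C (fst y) (snd y) * \<omega> (fst y) * \<omega> (snd y)"
  by (simp add: weighted_square_def split_beta)

section \<open>Relative entropy as a Legendre transform\<close>

definition tilt_gain :: "real \<Rightarrow> real \<Rightarrow> real \<Rightarrow> real" where
  "tilt_gain t x l = t * x - l * (exp t - 1)"

definition entropy_term :: "real \<Rightarrow> real \<Rightarrow> real" where
  "entropy_term x l = x * ln (x / l) - x + l"

text \<open>For positive x and l, put \<open>r = l * exp t / x\<close>; then the difference of the two sides is
\<open>x * (r - 1 - ln r)\<close>, which vanishes only for \<open>r = 1\<close>.\<close>
lemma tilt_gain_le:
  assumes "0 \<le> x" "0 \<le> l" "l = 0 \<longrightarrow> x = 0"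
  shows "tilt_gain t x l \<le> entropy_term x l"
    and "x \<noteq> l * exp t \<Longrightarrow> tilt_gain t x l < entropy_term x l"
proof -
  have "tilt_gain t x l \<le> entropy_term x l \<and> (x \<noteq> l * exp t \<longrightarrow> tilt_gain t x l < entropy_term x l)"
  proof (cases "x = 0")
    case True
    have "l \<noteq> 0 \<longrightarrow> l * exp t > 0" using assms by simp
    then show ?thesis using True by (auto simp: tilt_gain_def entropy_term_def algebra_simps)
  next
    case False
    then have pos: "x > 0" "l > 0" using assms by auto
    define r where "r = l * exp t / x"
    have xr: "l * exp t = x * r" using pos by (simp add: r_def)
    have r: "r > 0" using pos by (simp add: r_def)
    have lnr: "ln r = t - ln (x / l)" using pos by (simp add: r_def ln_mult ln_div)
    have id: "entropy_term x l - tilt_gain t x l = x * (r - 1 - ln r)"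
      using xr by (simp add: lnr entropy_term_def tilt_gain_def algebra_simps)
    have "ln r \<le> r - 1" using r by (rule ln_le_minus_one)
    moreover have "ln r \<noteq> r - 1" if "x \<noteq> l * exp t"
    proof
      assume "ln r = r - 1"
      then have "r = 1" using r by (intro ln_eq_minus_one)
      then show False using that pos by (simp add: r_def)
    qed
    ultimately have "0 \<le> x * (r - 1 - ln r)" "x \<noteq> l * exp t \<longrightarrow> 0 < x * (r - 1 - ln r)"
      using pos by (auto simp: order_less_le)
    then show ?thesis using id by auto
  qed
  then show "tilt_gain t x l \<le> entropy_term x l"
    and "x \<noteq> l * exp t \<Longrightarrow> tilt_gain t x l < entropy_term x l" by auto
qed

definition total_gain :: "('y::finite \<Rightarrow> real) \<Rightarrow> ('y \<Rightarrow> real) \<Rightarrow> ('y \<Rightarrow> real) \<Rightarrow> real" where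
  "total_gain g \<nu> \<rho> = (\<Sum>y\<in>UNIV. tilt_gain (g y) (\<nu> y) (\<rho> y))"

lemma total_gain_eq: "total_gain g \<nu> \<rho> = (\<Sum>y\<in>UNIV. g y * \<nu> y) - (\<Sum>y\<in>UNIV. \<rho> y * (exp (g y) - 1))"
  by (simp add: total_gain_def tilt_gain_def sum_subtractf)

lemma total_gain_zero [simp]: "total_gain (\<lambda>_. 0) \<nu> \<rho> = 0"
  by (simp add: total_gain_eq)

lemma total_gain_shift:
  "total_gain (\<lambda>y. g y + 1) \<nu> \<rho> - total_gain g \<nu> \<rho>
    = (\<Sum>y\<in>UNIV. \<nu> y) - (\<Sum>y\<in>UNIV. \<rho> y * (exp (g y + 1) - exp (g y)))"
  by (simp add: total_gain_eq distrib_right right_diff_distrib sum.distrib sum_subtractf)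

text \<open>For finite measures of arbitrary masses.  With \<open>\<rho> = C\<omega>\<otimes>\<omega>\<close> this is \<open>\<HH>\<^sub>C\<close>, and for equal masses it is the
relative entropy, so that the color part and the pair part of the rate function are treated alike.\<close>
definition gen_entropy :: "('y::finite \<Rightarrow> real) \<Rightarrow> ('y \<Rightarrow> real) \<Rightarrow> ereal" where
  "gen_entropy \<nu> \<rho> = (if \<forall>y. \<rho> y = 0 \<longrightarrow> \<nu> y = 0
     then ereal (\<Sum>y\<in>UNIV. entropy_term (\<nu> y) (\<rho> y)) else \<infinity>)"

lemma frak_H_eq_gen_entropy: "frak_H C \<pi> \<omega> = gen_entropy \<pi> (weighted_square C \<omega>)"
  by (simp add: frak_H_def rel_entropy_def gen_entropy_def total_mass_def entropy_term_def
      sum.distrib sum_subtractf)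

lemma rel_entropy_eq_gen_entropy:
  assumes "(\<Sum>y\<in>UNIV. \<nu> y) = (\<Sum>y\<in>UNIV. \<rho> y)"
  shows "rel_entropy \<nu> \<rho> = gen_entropy \<nu> \<rho>"
  using assms by (simp add: rel_entropy_def gen_entropy_def entropy_term_def sum.distrib sum_subtractf)

lemma total_gain_le_gen_entropy:
  assumes "\<And>y. 0 \<le> \<nu> y" "\<And>y. 0 \<le> \<rho> y"
  shows "ereal (total_gain g \<nu> \<rho>) \<le> gen_entropy \<nu> \<rho>"
  using assms by (auto simp: gen_entropy_def total_gain_def intro!: sum_mono tilt_gain_le(1))

lemma total_gain_less_gen_entropy:
  assumes "\<And>y. 0 \<le> \<nu> y" "\<And>y. 0 \<le> \<rho> y" and ne: "\<nu> \<noteq> (\<lambda>y. \<rho> y * exp (g y))"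
  shows "ereal (total_gain g \<nu> \<rho>) < gen_entropy \<nu> \<rho>"
proof (cases "\<forall>y. \<rho> y = 0 \<longrightarrow> \<nu> y = 0")
  case True
  obtain y where "\<nu> y \<noteq> \<rho> y * exp (g y)" using ne by blast
  then have "total_gain g \<nu> \<rho> < (\<Sum>y\<in>UNIV. entropy_term (\<nu> y) (\<rho> y))"
    unfolding total_gain_def using assms True
    by (intro sum_strict_mono_ex1) (auto intro!: tilt_gain_le)
  then show ?thesis using True by (simp add: gen_entropy_def)
next
  case False
  then have "gen_entropy \<nu> \<rho> = \<infinity>" by (auto simp: gen_entropy_def)
  then show ?thesis by simp
qed

lemma gen_entropy_nonneg:
  assumes "\<And>y. 0 \<le> \<nu> y" "\<And>y. 0 \<le> \<rho> y"
  shows "0 \<le> gen_entropy \<nu> \<rho>"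
  using total_gain_le_gen_entropy[OF assms, of "\<lambda>_. 0"]
  by (simp add: total_gain_def tilt_gain_def zero_ereal_def)

lemma tendsto_mult_ln:
  fixes x :: real and u :: "nat \<Rightarrow> real"
  assumes u: "u \<longlonglongrightarrow> x" and pos: "\<And>k. u k > 0" and l: "l > 0" and x: "0 \<le> x"
  shows "(\<lambda>k. u k * ln (u k / l)) \<longlonglongrightarrow> x * ln (x / l)"
proof (cases "x = 0")
  case True
  have "((\<lambda>y. y * ln (y / l)) \<longlongrightarrow> 0) (at_right 0)" using l by real_asymp
  moreover have "filterlim u (at_right 0) sequentially"
    using u pos True by (simp add: filterlim_at order_less_imp_not_eq2)
  ultimately show ?thesis using True by (auto intro: filterlim_compose)
next
  case False
  then show ?thesis using x l by (intro tendsto_intros u) auto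
qed

text \<open>Arbitrarily large weight on the points that \<open>\<nu>\<close> charges and \<open>\<rho>\<close> does not.\<close>
lemma dual_sequence_infinite:
  assumes nonneg: "\<And>y. 0 \<le> \<nu> y" and \<rho>: "\<rho> y0 = 0" "\<nu> y0 \<noteq> 0"
  shows "(\<lambda>k. ereal (total_gain (\<lambda>y. if \<rho> y = 0 then real k else 0) \<nu> \<rho>)) \<longlonglongrightarrow> gen_entropy \<nu> \<rho>"
proof -
  define m where "m = (\<Sum>y\<in>UNIV. if \<rho> y = 0 then \<nu> y else 0)"
  have "\<nu> y0 \<le> m"
    unfolding m_def using member_le_sum[of y0 UNIV "\<lambda>y. if \<rho> y = 0 then \<nu> y else 0"] \<rho>(1) nonneg by auto
  then have m: "m > 0" using \<rho>(2) nonneg[of y0] by linarith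
  have "total_gain (\<lambda>y. if \<rho> y = 0 then real k else 0) \<nu> \<rho> = real k * m" for k
    unfolding total_gain_def m_def sum_distrib_left by (rule sum.cong) (auto simp: tilt_gain_def)
  moreover have "filterlim (\<lambda>k. real k * m) at_top sequentially" using m by real_asymp
  moreover have "gen_entropy \<nu> \<rho> = \<infinity>" using \<rho> by (auto simp: gen_entropy_def)
  ultimately show ?thesis by (simp add: tendsto_PInfty_eq_at_top)
qed

text \<open>The optimal exponent \<open>ln (\<nu> / \<rho>)\<close> is not available where \<open>\<nu>\<close> vanishes, so \<open>\<nu>\<close> is replaced by positive
approximations u.  The measure \<open>\<rho>\<close> is approximated by v as well, since for the pair measure the reference
measure \<open>C\<omega>\<otimes>\<omega>\<close> moves with the approximation of \<open>\<omega>\<close>.  The third limit is the value of the gain at the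
tilted points; it rests on the continuity of \<open>x * ln x\<close> at zero.\<close>
lemma dual_sequence_finite:
  assumes \<nu>: "\<And>y. 0 \<le> \<nu> y" and \<rho>: "\<And>y. 0 \<le> \<rho> y" and ac: "\<And>y. \<rho> y = 0 \<Longrightarrow> \<nu> y = 0"
    and u: "\<And>y. \<rho> y \<noteq> 0 \<Longrightarrow> (\<lambda>k. u k y) \<longlonglongrightarrow> \<nu> y" "\<And>k y. \<rho> y \<noteq> 0 \<Longrightarrow> u k y > 0"
    and v: "\<And>y. (\<lambda>k. v k y) \<longlonglongrightarrow> \<rho> y"
    and g: "\<And>k y. g k y = (if \<rho> y = 0 then 0 else ln (u k y / \<rho> y))"
  shows "(\<lambda>k. ereal (total_gain (g k) \<nu> \<rho>)) \<longlonglongrightarrow> gen_entropy \<nu> \<rho>"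
    and "\<And>y. (\<lambda>k. v k y * exp (g k y)) \<longlonglongrightarrow> \<nu> y"
    and "(\<lambda>k. ereal (total_gain (g k) (\<lambda>y. v k y * exp (g k y)) (v k))) \<longlonglongrightarrow> gen_entropy \<nu> \<rho>"
proof -
  have pos: "\<rho> y > 0" if "\<rho> y \<noteq> 0" for y using \<rho>[of y] that by linarith
  have expg: "exp (g k y) = (if \<rho> y = 0 then 1 else u k y / \<rho> y)" for k y
    using u(2)[of y k] pos[of y] by (simp add: g)
  show lim: "(\<lambda>k. v k y * exp (g k y)) \<longlonglongrightarrow> \<nu> y" for y
  proof (cases "\<rho> y = 0")
    case True
    then show ?thesis using v[of y] ac[of y] by (simp add: expg)
  next
    case False
    have "(\<lambda>k. v k y * (u k y / \<rho> y)) \<longlonglongrightarrow> \<rho> y * (\<nu> y / \<rho> y)"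
      by (intro tendsto_intros v u False)
    then show ?thesis using False by (simp add: expg)
  qed
  have fin: "gen_entropy \<nu> \<rho> = ereal (\<Sum>y\<in>UNIV. entropy_term (\<nu> y) (\<rho> y))"
    using ac by (auto simp: gen_entropy_def)
  have "(\<lambda>k. tilt_gain (g k y) (\<nu> y) (\<rho> y)) \<longlonglongrightarrow> entropy_term (\<nu> y) (\<rho> y)" for y
  proof (cases "\<rho> y = 0")
    case True
    then show ?thesis using ac[of y] by (simp add: tilt_gain_def entropy_term_def)
  next
    case False
    have "(\<lambda>k. ln (u k y / \<rho> y) * \<nu> y) \<longlonglongrightarrow> ln (\<nu> y / \<rho> y) * \<nu> y"
    proof (cases "\<nu> y = 0")
      case True
      then show ?thesis by simp
    next
      case nz: False
      then show ?thesis using False pos[of y] by (intro tendsto_intros u) auto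
    qed
    moreover have "(\<lambda>k. \<rho> y * (u k y / \<rho> y - 1)) \<longlonglongrightarrow> \<rho> y * (\<nu> y / \<rho> y - 1)"
      by (intro tendsto_intros u False)
    ultimately have "(\<lambda>k. ln (u k y / \<rho> y) * \<nu> y - \<rho> y * (u k y / \<rho> y - 1))
        \<longlonglongrightarrow> ln (\<nu> y / \<rho> y) * \<nu> y - \<rho> y * (\<nu> y / \<rho> y - 1)"
      by (rule tendsto_diff)
    moreover have "ln (\<nu> y / \<rho> y) * \<nu> y - \<rho> y * (\<nu> y / \<rho> y - 1) = entropy_term (\<nu> y) (\<rho> y)"
      using False by (simp add: entropy_term_def field_simps)
    ultimately show ?thesis using False by (simp add: tilt_gain_def expg) (simp add: g)
  qed
  then show "(\<lambda>k. ereal (total_gain (g k) \<nu> \<rho>)) \<longlonglongrightarrow> gen_entropy \<nu> \<rho>"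
    unfolding fin total_gain_def by (intro tendsto_intros)
  have "(\<lambda>k. tilt_gain (g k y) (v k y * exp (g k y)) (v k y)) \<longlonglongrightarrow> entropy_term (\<nu> y) (\<rho> y)" for y
  proof (cases "\<rho> y = 0")
    case True
    then show ?thesis using ac[of y] by (simp add: tilt_gain_def entropy_term_def g)
  next
    case False
    have ulim: "(\<lambda>k. u k y * ln (u k y / \<rho> y)) \<longlonglongrightarrow> \<nu> y * ln (\<nu> y / \<rho> y)"
      by (rule tendsto_mult_ln) (use u False pos \<nu> in auto)
    have "(\<lambda>k. v k y / \<rho> y * (u k y * ln (u k y / \<rho> y)) - (v k y * exp (g k y) - v k y))
       \<longlonglongrightarrow> \<rho> y / \<rho> y * (\<nu> y * ln (\<nu> y / \<rho> y)) - (\<nu> y - \<rho> y)"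
      by (intro tendsto_diff tendsto_mult tendsto_divide ulim lim v tendsto_const False)
    moreover have "\<rho> y / \<rho> y * (\<nu> y * ln (\<nu> y / \<rho> y)) - (\<nu> y - \<rho> y) = entropy_term (\<nu> y) (\<rho> y)"
      using False by (simp add: entropy_term_def)
    moreover have "v k y / \<rho> y * (u k y * ln (u k y / \<rho> y)) - (v k y * exp (g k y) - v k y)
        = tilt_gain (g k y) (v k y * exp (g k y)) (v k y)" for k
      using False by (simp add: tilt_gain_def expg) (simp add: g field_simps)
    ultimately show ?thesis by simp
  qed
  then show "(\<lambda>k. ereal (total_gain (g k) (\<lambda>y. v k y * exp (g k y)) (v k))) \<longlonglongrightarrow> gen_entropy \<nu> \<rho>"
    unfolding fin total_gain_def by (intro tendsto_intros)
qed

text \<open>Mixing \<open>\<omega>\<close> with a vanishing fraction of \<open>\<mu>\<close> makes it positive on the support of \<open>\<mu>\<close> without changing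
the total mass, which is what the normalization of f asks for.\<close>
lemma color_sequence:
  fixes \<mu> :: "'a::finite pmf"
  assumes \<omega>: "\<omega> \<in> prob_measures"
  obtains f where "\<And>k. (\<Sum>a\<in>UNIV. pmf \<mu> a * exp (f k a)) = 1"
    and "(\<lambda>k. ereal (total_gain (f k) \<omega> (pmf \<mu>))) \<longlonglongrightarrow> gen_entropy \<omega> (pmf \<mu>)"
    and "\<And>a. gen_entropy \<omega> (pmf \<mu>) < \<infinity> \<Longrightarrow> (\<lambda>k. pmf \<mu> a * exp (f k a)) \<longlonglongrightarrow> \<omega> a"
    and "gen_entropy \<omega> (pmf \<mu>) < \<infinity> \<Longrightarrow>
      (\<lambda>k. ereal (total_gain (f k) (\<lambda>a. pmf \<mu> a * exp (f k a)) (pmf \<mu>))) \<longlonglongrightarrow> gen_entropy \<omega> (pmf \<mu>)"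
proof -
  note w0 = prob_measures_nonneg[OF \<omega>]
  have mu1: "(\<Sum>a\<in>UNIV. pmf \<mu> a) = 1" by (rule sum_pmf_eq_1) auto
  show ?thesis
  proof (cases "\<forall>a. pmf \<mu> a = 0 \<longrightarrow> \<omega> a = 0")
    case True
    define u where "u k a = (1 - 1 / real (Suc k)) * \<omega> a + 1 / real (Suc k) * pmf \<mu> a" for k a
    define f where "f k a = (if pmf \<mu> a = 0 then 0 else ln (u k a / pmf \<mu> a))" for k a
    have inv: "(\<lambda>k. 1 / real (Suc k)) \<longlonglongrightarrow> 0" by real_asymp
    have u_lim: "(\<lambda>k. u k a) \<longlonglongrightarrow> \<omega> a" for a
    proof -
      have "(\<lambda>k. u k a) \<longlonglongrightarrow> (1 - 0) * \<omega> a + 0 * pmf \<mu> a"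
        unfolding u_def by (intro tendsto_intros inv)
      then show ?thesis by simp
    qed
    have u_pos: "u k a > 0" if "pmf \<mu> a \<noteq> 0" for k a
    proof -
      have "0 \<le> (1 - 1 / real (Suc k)) * \<omega> a" using w0 by (intro mult_nonneg_nonneg) auto
      moreover have "0 < 1 / real (Suc k) * pmf \<mu> a" using that by (simp add: pmf_pos)
      ultimately show ?thesis unfolding u_def by linarith
    qed
    have tilt: "pmf \<mu> a * exp (f k a) = u k a" for k a
      using u_pos[of a k] True by (auto simp: f_def u_def pmf_pos zero_less_divide_iff)
    have "(\<Sum>a\<in>UNIV. u k a) = 1" for k
      using \<omega> mu1 by (simp add: u_def sum.distrib sum_distrib_left[symmetric]
          sum_divide_distrib[symmetric] prob_measures_def)
    then have norm: "(\<Sum>a\<in>UNIV. pmf \<mu> a * exp (f k a)) = 1" for k by (simp add: tilt)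
    have seq: "(\<lambda>k. ereal (total_gain (f k) \<omega> (pmf \<mu>))) \<longlonglongrightarrow> gen_entropy \<omega> (pmf \<mu>)"
      "(\<lambda>k. pmf \<mu> a * exp (f k a)) \<longlonglongrightarrow> \<omega> a"
      "(\<lambda>k. ereal (total_gain (f k) (\<lambda>a. pmf \<mu> a * exp (f k a)) (pmf \<mu>))) \<longlonglongrightarrow> gen_entropy \<omega> (pmf \<mu>)"
      for a
      by ((rule dual_sequence_finite[where g = f and \<nu> = \<omega> and \<rho> = "pmf \<mu>" and u = u and v = "\<lambda>_. pmf \<mu>"];
          (use w0 True u_lim u_pos in \<open>auto simp: f_def\<close>)))+
    show ?thesis by (rule that[OF norm seq(1) seq(2) seq(3)])
  next
    case False
    then obtain a0 where a0: "pmf \<mu> a0 = 0" "\<omega> a0 \<noteq> 0" by blast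
    define f where "f k a = (if pmf \<mu> a = 0 then real k else 0)" for k :: nat and a
    have "pmf \<mu> a * exp (f k a) = pmf \<mu> a" for k a by (simp add: f_def)
    then have norm: "(\<Sum>a\<in>UNIV. pmf \<mu> a * exp (f k a)) = 1" for k by (simp only: mu1)
    have inf: "gen_entropy \<omega> (pmf \<mu>) = \<infinity>" using a0 by (auto simp: gen_entropy_def)
    show ?thesis
      by (rule that[of f, OF norm])
        (use dual_sequence_infinite[of \<omega> "pmf \<mu>", OF w0 a0] in \<open>simp_all add: f_def[abs_def] inf\<close>)
  qed
qed

text \<open>The function g depends on \<open>\<omega>\<close> and \<open>\<pi>\<close> alone and works for every approximation \<open>\<omega>'\<close> of \<open>\<omega>\<close>: the constant
sequence serves the conditional law, and tilted color laws serve the joint law.\<close>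
lemma pair_sequence:
  assumes \<pi>: "\<pi> \<in> sym_finite_measures" and \<omega>: "\<And>a. 0 \<le> \<omega> a"
    and C: "\<And>a b. 0 \<le> C a b" "\<And>a b. C a b = C b a"
  obtains g :: "nat \<Rightarrow> 'a::finite \<times> 'a \<Rightarrow> real" where "\<And>k a b. g k (a, b) = g k (b, a)"
    and "(\<lambda>k. ereal (total_gain (g k) \<pi> (weighted_square C \<omega>))) \<longlonglongrightarrow> gen_entropy \<pi> (weighted_square C \<omega>)"
    and "\<And>\<omega>' y. gen_entropy \<pi> (weighted_square C \<omega>) < \<infinity> \<Longrightarrow> (\<And>a. (\<lambda>k. \<omega>' k a) \<longlonglongrightarrow> \<omega> a) \<Longrightarrow>
      (\<lambda>k. weighted_square C (\<omega>' k) y * exp (g k y)) \<longlonglongrightarrow> \<pi> y"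
    and "\<And>\<omega>'. gen_entropy \<pi> (weighted_square C \<omega>) < \<infinity> \<Longrightarrow> (\<And>a. (\<lambda>k. \<omega>' k a) \<longlonglongrightarrow> \<omega> a) \<Longrightarrow>
      (\<lambda>k. ereal (total_gain (g k) (\<lambda>y. weighted_square C (\<omega>' k) y * exp (g k y)) (weighted_square C (\<omega>' k))))
        \<longlonglongrightarrow> gen_entropy \<pi> (weighted_square C \<omega>)"
proof -
  define W where "W = weighted_square C \<omega>"
  have W0: "0 \<le> W y" for y using C \<omega> by (simp add: W_def weighted_square_apply)
  have Wsym: "W (a, b) = W (b, a)" for a b using C(2)[of a b] by (simp add: W_def weighted_square_apply)
  have \<pi>sym: "\<pi> (a, b) = \<pi> (b, a)" for a b using \<pi> by (simp add: sym_finite_measures_def)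
  note \<pi>0 = sym_finite_measures_nonneg[OF \<pi>]
  show ?thesis
  proof (cases "\<forall>y. W y = 0 \<longrightarrow> \<pi> y = 0")
    case True
    define u where "u k y = \<pi> y + 1 / real (Suc k)" for k y
    define g where "g k y = (if W y = 0 then 0 else ln (u k y / W y))" for k y
    have inv: "(\<lambda>k. 1 / real (Suc k)) \<longlonglongrightarrow> 0" by real_asymp
    have u_lim: "(\<lambda>k. u k y) \<longlonglongrightarrow> \<pi> y" for y
      using tendsto_add[OF tendsto_const[of "\<pi> y"] inv] by (simp add: u_def)
    have u_pos: "u k y > 0" for k y unfolding u_def using \<pi>0[of y] by (simp add: add_nonneg_pos)
    have seq: "(\<lambda>k. ereal (total_gain (g k) \<pi> W)) \<longlonglongrightarrow> gen_entropy \<pi> W"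
      "(\<lambda>k. v k y * exp (g k y)) \<longlonglongrightarrow> \<pi> y"
      "(\<lambda>k. ereal (total_gain (g k) (\<lambda>y. v k y * exp (g k y)) (v k))) \<longlonglongrightarrow> gen_entropy \<pi> W"
      if "\<And>y. (\<lambda>k. v k y) \<longlonglongrightarrow> W y" for v y
      by ((rule dual_sequence_finite[where g = g and \<nu> = \<pi> and \<rho> = W and u = u and v = v];
          (use \<pi>0 W0 True u_lim u_pos that in \<open>auto simp: g_def\<close>)))+
    have W_lim: "(\<lambda>k. weighted_square C (\<omega>' k) y) \<longlonglongrightarrow> W y" if "\<And>a. (\<lambda>k. \<omega>' k a) \<longlonglongrightarrow> \<omega> a" for \<omega>' :: "nat \<Rightarrow> 'a \<Rightarrow> real" and y
      unfolding W_def weighted_square_apply by (intro tendsto_intros that)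
    show ?thesis
    proof (rule that[of g], unfold W_def[symmetric])
      show "g k (a, b) = g k (b, a)" for k a b
        by (simp add: g_def u_def Wsym[of a b] \<pi>sym[of a b])
      show "(\<lambda>k. ereal (total_gain (g k) \<pi> W)) \<longlonglongrightarrow> gen_entropy \<pi> W"
        by (rule seq(1)[of "\<lambda>_. W"]) (rule tendsto_const)
      show "(\<lambda>k. weighted_square C (\<omega>' k) y * exp (g k y)) \<longlonglongrightarrow> \<pi> y"
        if "\<And>a. (\<lambda>k. \<omega>' k a) \<longlonglongrightarrow> \<omega> a" for \<omega>' y
        by (rule seq(2)[OF W_lim[OF that]])
      show "(\<lambda>k. ereal (total_gain (g k) (\<lambda>y. weighted_square C (\<omega>' k) y * exp (g k y)) (weighted_square C (\<omega>' k))))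
        \<longlonglongrightarrow> gen_entropy \<pi> W"
        if "\<And>a. (\<lambda>k. \<omega>' k a) \<longlonglongrightarrow> \<omega> a" for \<omega>'
        by (rule seq(3)[OF W_lim[OF that]])
    qed
  next
    case False
    then obtain y0 where y0: "W y0 = 0" "\<pi> y0 \<noteq> 0" by blast
    define g where "g k y = (if W y = 0 then real k else 0)" for k :: nat and y
    have inf: "gen_entropy \<pi> W = \<infinity>" using y0 by (metis gen_entropy_def)
    show ?thesis
    proof (rule that[of g], unfold W_def[symmetric])
      show "g k (a, b) = g k (b, a)" for k a b by (simp add: g_def Wsym[of a b])
      show "(\<lambda>k. ereal (total_gain (g k) \<pi> W)) \<longlonglongrightarrow> gen_entropy \<pi> W"
        using dual_sequence_infinite[of \<pi> W, OF \<pi>0 y0] by (simp add: g_def[abs_def])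
    qed (use inf in auto)
  qed
qed

section \<open>Tilted colored graphs\<close>

definition tilted_pmf :: "'a::finite pmf \<Rightarrow> ('a \<Rightarrow> real) \<Rightarrow> 'a pmf" where
  "tilted_pmf \<mu> f = embed_pmf (\<lambda>a. pmf \<mu> a * exp (f a))"

lemma pmf_tilted_pmf:
  assumes "(\<Sum>a\<in>UNIV. pmf \<mu> a * exp (f a)) = 1"
  shows "pmf (tilted_pmf \<mu> f) a = pmf \<mu> a * exp (f a)"
  unfolding tilted_pmf_def
proof (rule pmf_embed_pmf)
  show "(\<integral>\<^sup>+x. ennreal (pmf \<mu> x * exp (f x)) \<partial>count_space UNIV) = 1"
    using assms by (simp add: nn_integral_count_space_finite)
qed simp

text \<open>The probability p with its odds \<open>p / (1 - p)\<close> multiplied by \<open>exp t\<close>.\<close>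
definition tilted_prob :: "real \<Rightarrow> real \<Rightarrow> real" where
  "tilted_prob p t = p * exp t / (1 + p * (exp t - 1))"

lemma tilt_normalizer_pos:
  fixes p :: real
  assumes "0 \<le> p" "p \<le> 1"
  shows "1 + p * (exp t - 1) > 0"
proof -
  have "0 \<le> p * exp t" "p = 0 \<or> 0 < p * exp t" using assms by (auto simp: zero_less_mult_iff)
  moreover have "1 + p * (exp t - 1) = (1 - p) + p * exp t" by (simp add: algebra_simps)
  ultimately show ?thesis using assms by linarith
qed

lemma pmf_bernoulli_tilted_prob:
  assumes "0 \<le> p" "p \<le> 1"
  shows "pmf (bernoulli_pmf (tilted_prob p t)) b =
    pmf (bernoulli_pmf p) b * exp (of_bool b * t - ln (1 + p * (exp t - 1)))"
proof -
  define N where "N = 1 + p * (exp t - 1)"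
  have N: "N > 0" unfolding N_def using assms by (rule tilt_normalizer_pos)
  have q: "tilted_prob p t = p * exp t / N" by (simp add: tilted_prob_def N_def)
  have q1: "1 - tilted_prob p t = (1 - p) / N"
    using N by (simp add: q field_simps) (simp add: N_def algebra_simps)
  have "0 \<le> tilted_prob p t" using assms N by (simp add: q)
  moreover have "0 \<le> 1 - tilted_prob p t" using assms N unfolding q1 by simp
  ultimately have "pmf (bernoulli_pmf (tilted_prob p t)) b = (if b then p * exp t / N else (1 - p) / N)"
    using q q1 by (cases b) auto
  moreover have "exp (of_bool b * t - ln N) = (if b then exp t else 1) / N"
    using N by (simp add: exp_diff)
  ultimately show ?thesis
    unfolding N_def[symmetric] using assms by (cases b) auto
qed

lemma finite_vertex_pairs [simp]: "finite (vertex_pairs n)"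
  by (rule finite_subset[of _ "{1..n} \<times> {1..n}"]) (auto simp: vertex_pairs_def)

lemma pmf_colored_graph:
  "pmf (colored_graph \<mu> p n) (X, E) =
    (if (\<forall>v. v \<notin> {1..n} \<longrightarrow> X v = undefined) \<and> E \<subseteq> vertex_pairs n
     then (\<Prod>v\<in>{1..n}. pmf \<mu> (X v)) *
       (\<Prod>y\<in>vertex_pairs n. pmf (bernoulli_pmf (p (X (fst y)) (X (snd y)))) (y \<in> E))
     else 0)"
proof -
  define edges where "edges X = Pi_pmf (vertex_pairs n) False
      (\<lambda>(u, v). bernoulli_pmf (p (X u) (X v)))" for X :: "nat \<Rightarrow> 'a"
  have inner: "pmf (bind_pmf (edges Y) (\<lambda>e. return_pmf (Y, {uv. e uv}))) (X, E)
      = indicator {X} Y * pmf (edges X) (\<lambda>uv. uv \<in> E)" for Y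
  proof -
    have eq: "bind_pmf (edges Y) (\<lambda>e. return_pmf (Y, {uv. e uv})) = map_pmf (\<lambda>e. (Y, Collect e)) (edges Y)"
      by (simp add: map_pmf_def)
    show ?thesis
    proof (cases "Y = X")
      case True
      have "pmf (map_pmf (\<lambda>e. (X, Collect e)) (edges X)) ((\<lambda>e. (X, Collect e)) (\<lambda>uv. uv \<in> E))
          = pmf (edges X) (\<lambda>uv. uv \<in> E)"
        by (rule pmf_map_inj') (auto simp: inj_def Collect_inj)
      then show ?thesis unfolding eq using True by simp
    next
      case False
      then have "(X, E) \<notin> set_pmf (map_pmf (\<lambda>e. (Y, Collect e)) (edges Y))" by auto
      then show ?thesis using False by (simp add: eq pmf_eq_0_set_pmf)
    qed
  qed
  have "pmf (colored_graph \<mu> p n) (X, E) =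
      (\<integral>Y. indicator {X} Y * pmf (edges X) (\<lambda>uv. uv \<in> E) \<partial>measure_pmf (Pi_pmf {1..n} undefined (\<lambda>_. \<mu>)))"
    unfolding colored_graph_def edges_def[symmetric] by (subst pmf_bind) (simp only: inner)
  also have "\<dots> = pmf (Pi_pmf {1..n} undefined (\<lambda>_. \<mu>)) X * pmf (edges X) (\<lambda>uv. uv \<in> E)"
    by (simp add: measure_pmf_single)
  finally have product: "pmf (colored_graph \<mu> p n) (X, E) =
      pmf (Pi_pmf {1..n} undefined (\<lambda>_. \<mu>)) X * pmf (edges X) (\<lambda>uv. uv \<in> E)" .
  have colors: "pmf (Pi_pmf {1..n} undefined (\<lambda>_. \<mu>)) X =
      (if \<forall>v. v \<notin> {1..n} \<longrightarrow> X v = undefined then \<Prod>v\<in>{1..n}. pmf \<mu> (X v) else 0)"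
    by (rule pmf_Pi) simp
  have "(\<forall>y. y \<notin> vertex_pairs n \<longrightarrow> (y \<in> E) = False) \<longleftrightarrow> E \<subseteq> vertex_pairs n" by auto
  then have edges: "pmf (edges X) (\<lambda>uv. uv \<in> E) = (if E \<subseteq> vertex_pairs n
      then \<Prod>y\<in>vertex_pairs n. pmf (bernoulli_pmf (p (X (fst y)) (X (snd y)))) (y \<in> E) else 0)"
    unfolding edges_def pmf_Pi[OF finite_vertex_pairs] by (simp only: split_beta)
  show ?thesis
    unfolding product colors edges by auto
qed

lemma sum_color_eq:
  assumes "n \<ge> 1"
  shows "(\<Sum>v\<in>{1..n}. F (X v)) = real n * (\<Sum>a\<in>UNIV. F a * emp_color n (X, E) (a::'a::finite))"
proof -
  have "real n * (\<Sum>a\<in>UNIV. F a * emp_color n (X, E) a)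
      = (\<Sum>a\<in>UNIV. \<Sum>v\<in>{1..n}. F a * of_bool (X v = a))"
    using assms by (simp add: emp_color_def sum_distrib_left sum_distrib_right mult_ac)
  also have "\<dots> = (\<Sum>v\<in>{1..n}. \<Sum>a\<in>UNIV. F a * of_bool (X v = a))" by (rule sum.swap)
  also have "\<dots> = (\<Sum>v\<in>{1..n}. F (X v))"
  proof (rule sum.cong[OF refl])
    fix v
    have "(\<Sum>a\<in>UNIV. F a * of_bool (X v = a)) = (\<Sum>a\<in>UNIV. if a = X v then F a else 0)"
      by (rule sum.cong) auto
    then show "(\<Sum>a\<in>UNIV. F a * of_bool (X v = a)) = F (X v)" by simp
  qed
  finally show ?thesis by simp
qed

lemma emp_color_in_prob_measures:
  assumes "n \<ge> 1"
  shows "emp_color n x \<in> prob_measures"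
proof (cases x)
  case (Pair X E)
  have "real n = real n * (\<Sum>a\<in>UNIV. emp_color n (X, E) a)"
    using sum_color_eq[OF assms, of "\<lambda>_. 1" X E] by simp
  then have "(\<Sum>a\<in>UNIV. emp_color n (X, E) a) = 1" using assms by simp
  moreover have "0 \<le> emp_color n (X, E) a" for a
    unfolding emp_color_def prod.case by (intro mult_nonneg_nonneg sum_nonneg) auto
  ultimately show ?thesis by (simp add: prob_measures_def Pair)
qed

lemma emp_pair_in_sym_finite_measures: "emp_pair n x \<in> sym_finite_measures"
proof (cases x)
  case (Pair X E)
  have "emp_pair n (X, E) (a, b) = emp_pair n (X, E) (b, a)" for a b
    unfolding emp_pair_def prod.case by (simp add: conj_commute add.commute)
  moreover have "0 \<le> emp_pair n (X, E) y" for y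
    unfolding emp_pair_def prod.case by (intro mult_nonneg_nonneg sum_nonneg) auto
  ultimately show ?thesis by (simp add: sym_finite_measures_def Pair)
qed

lemma sum_edges_eq:
  fixes g :: "'a::finite \<times> 'a \<Rightarrow> real"
  assumes "n \<ge> 1" and sym: "\<And>a b. g (a, b) = g (b, a)"
  shows "(\<Sum>y\<in>E. g (X (fst y), X (snd y))) = real n / 2 * (\<Sum>z\<in>UNIV. g z * emp_pair n (X, E) z)"
proof -
  have "real n * (\<Sum>z\<in>UNIV. g z * emp_pair n (X, E) z)
     = (\<Sum>z\<in>UNIV. \<Sum>y\<in>E. g z * (of_bool ((X (snd y), X (fst y)) = z) + of_bool ((X (fst y), X (snd y)) = z)))"
    using assms(1) by (simp add: emp_pair_def sum_distrib_left split_beta mult_ac)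
  also have "\<dots> = (\<Sum>y\<in>E. \<Sum>z\<in>UNIV. g z * (of_bool ((X (snd y), X (fst y)) = z) + of_bool ((X (fst y), X (snd y)) = z)))"
    by (rule sum.swap)
  also have "\<dots> = (\<Sum>y\<in>E. 2 * g (X (fst y), X (snd y)))"
  proof (rule sum.cong[OF refl])
    fix y
    have pick: "(\<Sum>z\<in>UNIV. g z * of_bool (w = z)) = g w" for w
    proof -
      have "(\<Sum>z\<in>UNIV. g z * of_bool (w = z)) = (\<Sum>z\<in>UNIV. if z = w then g z else 0)"
        by (rule sum.cong) auto
      then show ?thesis by simp
    qed
    show "(\<Sum>z\<in>UNIV. g z * (of_bool ((X (snd y), X (fst y)) = z) + of_bool ((X (fst y), X (snd y)) = z)))
       = 2 * g (X (fst y), X (snd y))"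
      unfolding distrib_left sum.distrib pick using sym by simp
  qed
  finally show ?thesis by (simp add: sum_distrib_left[symmetric])
qed

text \<open>The square of the vertex set consists of the pairs with \<open>u < v\<close>, their mirror images and the diagonal.
The whole square gives the quadratic form in the empirical color measure.  The diagonal is smaller by a
factor n.\<close>
lemma sum_vertex_pairs_eq:
  fixes G :: "'a::finite \<Rightarrow> 'a \<Rightarrow> real" and X :: "nat \<Rightarrow> 'a" and E :: "(nat \<times> nat) set"
  assumes n: "n \<ge> 1" and sym: "\<And>a b. G a b = G b a"
  defines "\<omega> \<equiv> emp_color n (X, E)"
  shows "(\<Sum>y\<in>vertex_pairs n. G (X (fst y)) (X (snd y)))
    = real n / 2 * ((\<Sum>z\<in>UNIV. real n * G (fst z) (snd z) * \<omega> (fst z) * \<omega> (snd z))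
        - (\<Sum>a\<in>UNIV. G a a * \<omega> a))"
proof -
  define V where "V = {1..n}"
  define H where "H y = G (X (fst y)) (X (snd y))" for y :: "nat \<times> nat"
  have split: "V \<times> V = vertex_pairs n \<union> (prod.swap ` vertex_pairs n \<union> (\<lambda>v. (v, v)) ` V)"
    unfolding V_def vertex_pairs_def by (auto simp: image_iff)
  have "(\<Sum>y\<in>V \<times> V. H y) = (\<Sum>y\<in>vertex_pairs n. H y) +
      ((\<Sum>y\<in>prod.swap ` vertex_pairs n. H y) + (\<Sum>y\<in>(\<lambda>v. (v, v)) ` V. H y))"
  proof -
    have fin: "finite (prod.swap ` vertex_pairs n)" "finite ((\<lambda>v. (v, v)) ` V)"
      by (auto simp: V_def)
    have disj: "vertex_pairs n \<inter> (prod.swap ` vertex_pairs n \<union> (\<lambda>v. (v, v)) ` V) = {}"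
      "prod.swap ` vertex_pairs n \<inter> (\<lambda>v. (v, v)) ` V = {}"
      by (auto simp: vertex_pairs_def)
    show ?thesis
      unfolding split using fin disj by (simp add: sum.union_disjoint)
  qed
  also have "(\<Sum>y\<in>prod.swap ` vertex_pairs n. H y) = (\<Sum>y\<in>vertex_pairs n. H y)"
    by (subst sum.reindex) (auto simp: H_def sym intro: inj_onI)
  also have "(\<Sum>y\<in>(\<lambda>v. (v, v)) ` V. H y) = (\<Sum>v\<in>V. G (X v) (X v))"
    by (subst sum.reindex) (auto simp: H_def intro: inj_onI)
  also have "\<dots> = real n * (\<Sum>a\<in>UNIV. G a a * \<omega> a)"
    unfolding V_def \<omega>_def by (rule sum_color_eq[OF n])
  finally have 1: "(\<Sum>y\<in>V \<times> V. H y) =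
      2 * (\<Sum>y\<in>vertex_pairs n. H y) + real n * (\<Sum>a\<in>UNIV. G a a * \<omega> a)" by simp
  have "(\<Sum>y\<in>V \<times> V. H y) = (\<Sum>u\<in>V. \<Sum>v\<in>V. G (X u) (X v))"
    by (simp add: sum.cartesian_product H_def split_beta)
  also have "\<dots> = (\<Sum>u\<in>V. real n * (\<Sum>b\<in>UNIV. G (X u) b * \<omega> b))"
    unfolding V_def \<omega>_def by (rule sum.cong[OF refl], rule sum_color_eq[OF n])
  also have "\<dots> = real n * (\<Sum>a\<in>UNIV. (real n * (\<Sum>b\<in>UNIV. G a b * \<omega> b)) * \<omega> a)"
    unfolding V_def \<omega>_def by (rule sum_color_eq[OF n])
  also have "\<dots> = real n * (\<Sum>a\<in>UNIV. \<Sum>b\<in>UNIV. real n * G a b * \<omega> a * \<omega> b)"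
    by (simp add: sum_distrib_left sum_distrib_right mult_ac)
  also have "\<dots> = real n * (\<Sum>z\<in>UNIV. real n * G (fst z) (snd z) * \<omega> (fst z) * \<omega> (snd z))"
    by (simp add: sum.cartesian_product split_beta)
  finally show ?thesis using 1 by (simp add: H_def algebra_simps)
qed

text \<open>The two product formulas are compared factor by factor.  The tilts of the vertices and of the present edges
add up to integrals against the empirical measures, and the normalizers of all vertex pairs
add up to the quadratic form of \<open>sum_vertex_pairs_eq\<close>.\<close>
lemma tilted_density:
  fixes \<mu> :: "'a::finite pmf" and g :: "'a \<times> 'a \<Rightarrow> real"
  assumes n: "n \<ge> 1"
    and p: "\<And>a b. 0 \<le> p a b \<and> p a b \<le> 1" "\<And>a b. p a b = p b a"
    and f: "(\<Sum>a\<in>UNIV. pmf \<mu> a * exp (f a)) = 1"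
    and g: "\<And>a b. g (a, b) = g (b, a)"
  defines "N \<equiv> \<lambda>a b. ln (1 + p a b * (exp (g (a, b)) - 1))"
  shows "pmf (colored_graph (tilted_pmf \<mu> f) (\<lambda>a b. tilted_prob (p a b) (g (a, b))) n) x =
    pmf (colored_graph \<mu> p n) x *
    exp (real n * ((\<Sum>a\<in>UNIV. f a * emp_color n x a)
      + 1 / 2 * ((\<Sum>z\<in>UNIV. g z * emp_pair n x z)
        - (\<Sum>z\<in>UNIV. real n * N (fst z) (snd z) * emp_color n x (fst z) * emp_color n x (snd z))
        + (\<Sum>a\<in>UNIV. N a a * emp_color n x a))))"
proof (cases x)
  case (Pair X E)
  show ?thesis
  proof (cases "(\<forall>v. v \<notin> {1..n} \<longrightarrow> X v = undefined) \<and> E \<subseteq> vertex_pairs n")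
    case True
    have Nsym: "N a b = N b a" for a b using p(2)[of a b] g[of a b] by (simp add: N_def)
    have "(\<Sum>y\<in>vertex_pairs n. of_bool (y \<in> E) * g (X (fst y), X (snd y)) - N (X (fst y)) (X (snd y)))
      = (\<Sum>y\<in>E. g (X (fst y), X (snd y))) - (\<Sum>y\<in>vertex_pairs n. N (X (fst y)) (X (snd y)))"
    proof -
      have "(\<Sum>y\<in>vertex_pairs n. of_bool (y \<in> E) * g (X (fst y), X (snd y)))
          = (\<Sum>y\<in>vertex_pairs n \<inter> E. g (X (fst y), X (snd y)))"
        by simp
      also have "vertex_pairs n \<inter> E = E" using True by auto
      finally show ?thesis by (simp add: sum_subtractf)
    qed
    then have exponent: "(\<Sum>v\<in>{1..n}. f (X v)) +
        (\<Sum>y\<in>vertex_pairs n. of_bool (y \<in> E) * g (X (fst y), X (snd y)) - N (X (fst y)) (X (snd y)))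
      = real n * ((\<Sum>a\<in>UNIV. f a * emp_color n x a)
      + 1 / 2 * ((\<Sum>z\<in>UNIV. g z * emp_pair n x z)
        - (\<Sum>z\<in>UNIV. real n * N (fst z) (snd z) * emp_color n x (fst z) * emp_color n x (snd z))
        + (\<Sum>a\<in>UNIV. N a a * emp_color n x a)))"
      unfolding Pair sum_edges_eq[of n g X E, OF n g] sum_vertex_pairs_eq[of n N X E, OF n Nsym] sum_color_eq[OF n, of f X E]
      by (simp add: algebra_simps)
    have "pmf (colored_graph (tilted_pmf \<mu> f) (\<lambda>a b. tilted_prob (p a b) (g (a, b))) n) (X, E) =
      (\<Prod>v\<in>{1..n}. pmf \<mu> (X v) * exp (f (X v))) *
      (\<Prod>y\<in>vertex_pairs n. pmf (bernoulli_pmf (p (X (fst y)) (X (snd y)))) (y \<in> E) *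
         exp (of_bool (y \<in> E) * g (X (fst y), X (snd y)) - N (X (fst y)) (X (snd y))))"
      using True p(1) by (simp add: pmf_colored_graph pmf_tilted_pmf[OF f] pmf_bernoulli_tilted_prob N_def)
    also have "\<dots> = pmf (colored_graph \<mu> p n) (X, E) * exp ((\<Sum>v\<in>{1..n}. f (X v)) +
        (\<Sum>y\<in>vertex_pairs n. of_bool (y \<in> E) * g (X (fst y), X (snd y)) - N (X (fst y)) (X (snd y))))"
      using True by (simp add: pmf_colored_graph prod.distrib exp_add exp_sum mult_ac)
    finally show ?thesis unfolding exponent by (simp add: Pair)
  next
    case False
    then have "pmf (colored_graph \<nu> q n) x = 0" for \<nu> :: "'a pmf" and q
      unfolding Pair pmf_colored_graph by auto
    then show ?thesis by simp
  qed
qed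

lemma tendsto_mult_ln_one_plus:
  fixes x :: "nat \<Rightarrow> real"
  assumes x: "(\<lambda>n. real n * x n) \<longlonglongrightarrow> c"
  shows "(\<lambda>n. real n * ln (1 + x n)) \<longlonglongrightarrow> c" and "(\<lambda>n. ln (1 + x n)) \<longlonglongrightarrow> 0"
proof -
  have inv: "(\<lambda>n. 1 / real n) \<longlonglongrightarrow> 0" by real_asymp
  have "(\<lambda>n. (real n * x n) * (1 / real n)) \<longlonglongrightarrow> c * 0"
    by (intro tendsto_mult x inv)
  then have "(\<lambda>n. (real n * x n) * (1 / real n)) \<longlonglongrightarrow> 0" by simp
  moreover have "\<forall>\<^sub>F n in sequentially. (real n * x n) * (1 / real n) = x n"
    using eventually_gt_at_top[of 0] by eventually_elim simp
  ultimately have x0: "x \<longlonglongrightarrow> 0" by (rule Lim_transform_eventually)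
  \<comment> \<open>squeeze between \<open>x / (1 + x) \<le> ln (1 + x) \<le> x\<close>\<close>
  have pos: "\<forall>\<^sub>F n in sequentially. x n > - 1" using x0 by (rule order_tendstoD) simp
  show "(\<lambda>n. real n * ln (1 + x n)) \<longlonglongrightarrow> c"
  proof (rule tendsto_sandwich)
    show "\<forall>\<^sub>F n in sequentially. (real n * x n) / (1 + x n) \<le> real n * ln (1 + x n)"
      using pos
    proof eventually_elim
      case (elim n)
      have "- ln (1 + x n) \<le> 1 / (1 + x n) - 1"
        using ln_le_minus_one[of "1 / (1 + x n)"] elim by (simp add: ln_div)
      then have "x n / (1 + x n) \<le> ln (1 + x n)" using elim by (simp add: field_simps)
      then have "real n * (x n / (1 + x n)) \<le> real n * ln (1 + x n)" by (rule mult_left_mono) simp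
      then show ?case by simp
    qed
    show "\<forall>\<^sub>F n in sequentially. real n * ln (1 + x n) \<le> real n * x n"
      using pos
    proof eventually_elim
      case (elim n)
      then have "ln (1 + x n) \<le> x n" using ln_le_minus_one[of "1 + x n"] by simp
      then show ?case by (rule mult_left_mono) simp
    qed
    have "(\<lambda>n. (real n * x n) / (1 + x n)) \<longlonglongrightarrow> c / (1 + 0)"
      by (intro tendsto_intros x x0) simp
    then show "(\<lambda>n. (real n * x n) / (1 + x n)) \<longlonglongrightarrow> c" by simp
  qed (rule x)
  have "(\<lambda>n. ln (1 + x n)) \<longlonglongrightarrow> ln (1 + 0)" by (intro tendsto_intros x0) simp
  then show "(\<lambda>n. ln (1 + x n)) \<longlonglongrightarrow> 0" by simp
qed

text \<open>As \<open>n * p n a b \<longlonglongrightarrow> C a b\<close>, also \<open>n * ln (1 + p n a b * (exp (g (a, b)) - 1))\<close> tends to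
\<open>C a b * (exp (g (a, b)) - 1)\<close>, and the diagonal term vanishes.  There are only finitely many coefficients
and the color frequencies are bounded by one, so the convergence is uniform in \<open>\<omega>\<close>.\<close>
lemma log_normalizer_limit:
  fixes C :: "'a::finite \<Rightarrow> 'a \<Rightarrow> real" and g :: "'a \<times> 'a \<Rightarrow> real"
  assumes p_lim: "\<And>a b. (\<lambda>n. real n * p n a b) \<longlonglongrightarrow> C a b" and \<epsilon>: "\<epsilon> > 0"
  defines "N \<equiv> \<lambda>n a b. ln (1 + p n a b * (exp (g (a, b)) - 1))"
  shows "\<forall>\<^sub>F n in sequentially. \<forall>\<omega>\<in>prob_measures.
    \<bar>(\<Sum>z\<in>UNIV. real n * N n (fst z) (snd z) * \<omega> (fst z) * \<omega> (snd z))
      - (\<Sum>a\<in>UNIV. N n a a * \<omega> a)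
      - (\<Sum>z\<in>UNIV. weighted_square C \<omega> z * (exp (g z) - 1))\<bar> \<le> \<epsilon>"
proof -
  define c where "c z = C (fst z) (snd z) * (exp (g z) - 1)" for z
  define \<delta> where "\<delta> n = (\<Sum>z\<in>UNIV. \<bar>real n * N n (fst z) (snd z) - c z\<bar>) + (\<Sum>a\<in>UNIV. \<bar>N n a a\<bar>)" for n
  have np: "(\<lambda>n. real n * (p n a b * (exp (g (a, b)) - 1))) \<longlonglongrightarrow> C a b * (exp (g (a, b)) - 1)" for a b
    using tendsto_mult[OF p_lim[of a b] tendsto_const[of "exp (g (a, b)) - 1"]] by (simp add: mult.assoc)
  have N1: "(\<lambda>n. real n * N n a b) \<longlonglongrightarrow> C a b * (exp (g (a, b)) - 1)" for a b
    unfolding N_def by (rule tendsto_mult_ln_one_plus(1)[OF np])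
  have N0: "(\<lambda>n. N n a b) \<longlonglongrightarrow> 0" for a b
    unfolding N_def by (rule tendsto_mult_ln_one_plus(2)[OF np])
  have "\<delta> \<longlonglongrightarrow> (\<Sum>z::'a \<times> 'a\<in>UNIV. \<bar>c z - c z\<bar>) + (\<Sum>a::'a\<in>UNIV. \<bar>0\<bar>)"
    unfolding \<delta>_def by (intro tendsto_add tendsto_sum tendsto_rabs tendsto_diff tendsto_const N0)
      (use N1 in \<open>auto simp: c_def\<close>)
  then have "\<delta> \<longlonglongrightarrow> 0" by simp
  then have "\<forall>\<^sub>F n in sequentially. \<delta> n < \<epsilon>" using \<epsilon> by (rule order_tendstoD)
  then show ?thesis
  proof eventually_elim
    case (elim n)
    show ?case
    proof
      fix \<omega> :: "'a \<Rightarrow> real" assume \<omega>: "\<omega> \<in> prob_measures"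
      note w0 = prob_measures_nonneg[OF \<omega>] and w1 = prob_measures_le_1[OF \<omega>]
      have prod1: "\<bar>t * \<omega> a * \<omega> b\<bar> \<le> \<bar>t\<bar>" for t a b
      proof -
        have "\<omega> a * \<omega> b \<le> 1" using mult_mono[OF w1[of a] w1[of b]] w0 by simp
        then have "\<bar>t\<bar> * (\<omega> a * \<omega> b) \<le> \<bar>t\<bar> * 1" by (intro mult_left_mono) auto
        then show ?thesis using w0 by (simp add: abs_mult mult.assoc)
      qed
      have one: "\<bar>t * \<omega> a\<bar> \<le> \<bar>t\<bar>" for t a
        using mult_left_mono[OF w1[of a], of "\<bar>t\<bar>"] w0[of a] by (simp add: abs_mult)
      have "(\<Sum>z\<in>UNIV. real n * N n (fst z) (snd z) * \<omega> (fst z) * \<omega> (snd z))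
          - (\<Sum>z\<in>UNIV. weighted_square C \<omega> z * (exp (g z) - 1))
        = (\<Sum>z\<in>UNIV. (real n * N n (fst z) (snd z) - c z) * \<omega> (fst z) * \<omega> (snd z))"
        by (simp add: sum_subtractf[symmetric] weighted_square_apply c_def algebra_simps)
      also have "\<bar>\<dots>\<bar> \<le> (\<Sum>z\<in>UNIV. \<bar>real n * N n (fst z) (snd z) - c z\<bar>)"
        by (intro order_trans[OF sum_abs] sum_mono prod1)
      finally have 1: "\<bar>(\<Sum>z\<in>UNIV. real n * N n (fst z) (snd z) * \<omega> (fst z) * \<omega> (snd z))
          - (\<Sum>z\<in>UNIV. weighted_square C \<omega> z * (exp (g z) - 1))\<bar>
          \<le> (\<Sum>z\<in>UNIV. \<bar>real n * N n (fst z) (snd z) - c z\<bar>)" .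
      have 2: "\<bar>\<Sum>a\<in>UNIV. N n a a * \<omega> a\<bar> \<le> (\<Sum>a\<in>UNIV. \<bar>N n a a\<bar>)"
        by (intro order_trans[OF sum_abs] sum_mono one)
      show "\<bar>(\<Sum>z\<in>UNIV. real n * N n (fst z) (snd z) * \<omega> (fst z) * \<omega> (snd z))
          - (\<Sum>a\<in>UNIV. N n a a * \<omega> a)
          - (\<Sum>z\<in>UNIV. weighted_square C \<omega> z * (exp (g z) - 1))\<bar> \<le> \<epsilon>"
        using 1 2 elim unfolding \<delta>_def by linarith
    qed
  qed
qed

lemma graph_density:
  fixes \<mu> :: "'a::finite pmf" and g :: "'a \<times> 'a \<Rightarrow> real"
  assumes p_range: "\<And>n a b. n \<ge> 1 \<Longrightarrow> 0 \<le> p n a b \<and> p n a b \<le> 1"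
    and p_sym: "\<And>n a b. n \<ge> 1 \<Longrightarrow> p n a b = p n b a"
    and p_lim: "\<And>a b. (\<lambda>n. real n * p n a b) \<longlonglongrightarrow> C a b"
    and f: "(\<Sum>a\<in>UNIV. pmf \<mu> a * exp (f a)) = 1"
    and g: "\<And>a b. g (a, b) = g (b, a)"
    and \<epsilon>: "\<epsilon> > 0"
  defines "L \<equiv> \<lambda>n x. total_gain f (emp_color n x) (pmf \<mu>)
      + 1 / 2 * total_gain g (emp_pair n x) (weighted_square C (emp_color n x))"
    and "Q \<equiv> \<lambda>n. colored_graph (tilted_pmf \<mu> f) (\<lambda>a b. tilted_prob (p n a b) (g (a, b))) n"
  shows "\<forall>\<^sub>F n in sequentially. \<forall>x.
      exp (real n * (L n x - \<epsilon>)) * pmf (colored_graph \<mu> (p n) n) x \<le> pmf (Q n) x \<and>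
      pmf (Q n) x \<le> exp (real n * (L n x + \<epsilon>)) * pmf (colored_graph \<mu> (p n) n) x"
proof -
  define N where "N n a b = ln (1 + p n a b * (exp (g (a, b)) - 1))" for n a b
  have "2 * \<epsilon> > 0" using \<epsilon> by simp
  from log_normalizer_limit[where g = g and p = p and C = C, OF p_lim this] show ?thesis
    using eventually_ge_at_top[of 1]
  proof eventually_elim
    case (elim n)
    show ?case
    proof
      fix x :: "(nat \<Rightarrow> 'a) \<times> (nat \<times> nat) set"
      define \<omega> where "\<omega> = emp_color n x"
      define R where "R = (\<Sum>z\<in>UNIV. real n * N n (fst z) (snd z) * \<omega> (fst z) * \<omega> (snd z))
          - (\<Sum>a\<in>UNIV. N n a a * \<omega> a)"
      define A where "A = (\<Sum>a\<in>UNIV. f a * \<omega> a) + 1 / 2 * ((\<Sum>z\<in>UNIV. g z * emp_pair n x z) - R)"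
      have "\<omega> \<in> prob_measures" unfolding \<omega>_def using elim(2) by (rule emp_color_in_prob_measures)
      then have R: "\<bar>R - (\<Sum>z\<in>UNIV. weighted_square C \<omega> z * (exp (g z) - 1))\<bar> \<le> 2 * \<epsilon>"
        using elim(1) unfolding R_def N_def by blast
      have "(\<Sum>a\<in>UNIV. pmf \<mu> a) = 1" by (rule sum_pmf_eq_1) auto
      then have "total_gain f \<omega> (pmf \<mu>) = (\<Sum>a\<in>UNIV. f a * \<omega> a)"
        using f by (simp add: total_gain_eq right_diff_distrib sum_subtractf)
      then have "A - L n x = ((\<Sum>z\<in>UNIV. weighted_square C \<omega> z * (exp (g z) - 1)) - R) / 2"
        unfolding L_def A_def \<omega>_def[symmetric] total_gain_eq[of g] by (simp add: field_simps)
      then have AL: "\<bar>A - L n x\<bar> \<le> \<epsilon>" using R by (simp add: abs_le_iff)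
      have dens: "pmf (Q n) x = pmf (colored_graph \<mu> (p n) n) x * exp (real n * A)"
        unfolding Q_def A_def R_def N_def \<omega>_def
        using tilted_density[where p = "p n" and f = f and g = g and \<mu> = \<mu>, OF elim(2) p_range[OF elim(2)] p_sym[OF elim(2)] f g, of x]
        by (simp add: algebra_simps)
      have "exp (real n * (L n x - \<epsilon>)) \<le> exp (real n * A)" "exp (real n * A) \<le> exp (real n * (L n x + \<epsilon>))"
        using AL by (auto intro!: mult_left_mono simp: abs_le_iff)
      then show "exp (real n * (L n x - \<epsilon>)) * pmf (colored_graph \<mu> (p n) n) x \<le> pmf (Q n) x \<and>
        pmf (Q n) x \<le> exp (real n * (L n x + \<epsilon>)) * pmf (colored_graph \<mu> (p n) n) x"
        unfolding dens mult.commute[of "pmf (colored_graph \<mu> (p n) n) x"]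
        by (auto intro!: mult_right_mono)
    qed
  qed
qed

text \<open>The colors are the first marginal of the colored graph, whatever the edge probabilities.  So the
conditioning event has the same probability before and after tilting the edges.\<close>
lemma prob_emp_color_colored_graph:
  "measure_pmf.prob (colored_graph \<mu> p n) {x. emp_color n x = \<omega>} =
   measure_pmf.prob (Pi_pmf {1..n} undefined (\<lambda>_. \<mu>)) {X. emp_color n (X, {}) = \<omega>}"
proof -
  have "map_pmf fst (colored_graph \<mu> p n) = Pi_pmf {1..n} undefined (\<lambda>_. \<mu>)"
    by (simp add: colored_graph_def map_bind_pmf bind_return_pmf')
  then have "measure_pmf.prob (Pi_pmf {1..n} undefined (\<lambda>_. \<mu>)) {X. emp_color n (X, {}) = \<omega>}
      = measure_pmf.prob (colored_graph \<mu> p n) (fst -` {X. emp_color n (X, {}) = \<omega>})"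
    by (metis measure_map_pmf)
  also have "fst -` {X. emp_color n (X, {}) = \<omega>} = {x. emp_color n x = \<omega>}"
    by (auto simp: emp_color_def split_beta)
  finally show ?thesis by simp
qed

lemma tilted_pmf_zero: "tilted_pmf \<mu> (\<lambda>_. 0) = (\<mu> :: 'a::finite pmf)"
proof (rule pmf_eqI)
  have "(\<Sum>a\<in>UNIV. pmf \<mu> a) = 1" by (rule sum_pmf_eq_1) auto
  then show "pmf (tilted_pmf \<mu> (\<lambda>_. 0)) a = pmf \<mu> a" for a
    by (subst pmf_tilted_pmf) auto
qed

text \<open>The two conditional laws have the same normalizing factor, and on the conditioning event the empirical
color measure is \<open>\<omega>n n\<close>.  Replacing it by its limit costs a uniform \<open>o(1)\<close> in the exponent, because
the measure \<open>\<pi>\<close> enters the gain only through a term that does not involve the colors.\<close>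
lemma conditional_graph_density:
  fixes \<mu> :: "'a::finite pmf" and g :: "'a \<times> 'a \<Rightarrow> real"
  assumes p_range: "\<And>n a b. n \<ge> 1 \<Longrightarrow> 0 \<le> p n a b \<and> p n a b \<le> 1"
    and p_sym: "\<And>n a b. n \<ge> 1 \<Longrightarrow> p n a b = p n b a"
    and p_lim: "\<And>a b. (\<lambda>n. real n * p n a b) \<longlonglongrightarrow> C a b"
    and g: "\<And>a b. g (a, b) = g (b, a)"
    and \<omega>n: "\<And>a. (\<lambda>n. \<omega>n n a) \<longlonglongrightarrow> \<omega> a"
    and pos: "\<And>n. n \<ge> 1 \<Longrightarrow> measure_pmf.prob (colored_graph \<mu> (p n) n) {x. emp_color n x = \<omega>n n} > 0"
    and \<epsilon>: "\<epsilon> > 0"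
  defines "L \<equiv> \<lambda>n x. 1 / 2 * total_gain g (emp_pair n x) (weighted_square C \<omega>)"
    and "P \<equiv> \<lambda>n. cond_pmf (colored_graph \<mu> (p n) n) {x. emp_color n x = \<omega>n n}"
    and "Q \<equiv> \<lambda>n. cond_pmf (colored_graph \<mu> (\<lambda>a b. tilted_prob (p n a b) (g (a, b))) n)
      {x. emp_color n x = \<omega>n n}"
  shows "\<forall>\<^sub>F n in sequentially. \<forall>x.
      exp (real n * (L n x - \<epsilon>)) * pmf (P n) x \<le> pmf (Q n) x \<and>
      pmf (Q n) x \<le> exp (real n * (L n x + \<epsilon>)) * pmf (P n) x"
proof -
  define G where "G \<omega>' = (\<Sum>z\<in>UNIV. weighted_square C \<omega>' z * (exp (g z) - 1))" for \<omega>'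
  have "(\<lambda>n. G (\<omega>n n)) \<longlonglongrightarrow> G \<omega>"
    unfolding G_def weighted_square_apply by (intro tendsto_intros \<omega>n)
  then have "(\<lambda>n. \<bar>G (\<omega>n n) - G \<omega>\<bar>) \<longlonglongrightarrow> 0"
    by (simp add: LIM_zero_iff tendsto_rabs_zero_iff)
  then have close: "\<forall>\<^sub>F n in sequentially. \<bar>G (\<omega>n n) - G \<omega>\<bar> < \<epsilon>" using \<epsilon> by (rule order_tendstoD)
  have norm: "(\<Sum>a\<in>UNIV. pmf \<mu> a * exp 0) = 1" using sum_pmf_eq_1[of UNIV \<mu>] by simp
  have "\<forall>\<^sub>F n in sequentially. \<forall>x.
      exp (real n * (total_gain (\<lambda>_. 0) (emp_color n x) (pmf \<mu>)
          + 1 / 2 * total_gain g (emp_pair n x) (weighted_square C (emp_color n x)) - \<epsilon> / 2))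
        * pmf (colored_graph \<mu> (p n) n) x
      \<le> pmf (colored_graph (tilted_pmf \<mu> (\<lambda>_. 0)) (\<lambda>a b. tilted_prob (p n a b) (g (a, b))) n) x \<and>
      pmf (colored_graph (tilted_pmf \<mu> (\<lambda>_. 0)) (\<lambda>a b. tilted_prob (p n a b) (g (a, b))) n) x
      \<le> exp (real n * (total_gain (\<lambda>_. 0) (emp_color n x) (pmf \<mu>)
          + 1 / 2 * total_gain g (emp_pair n x) (weighted_square C (emp_color n x)) + \<epsilon> / 2))
        * pmf (colored_graph \<mu> (p n) n) x"
    using \<epsilon> by (intro graph_density p_lim norm) (use p_range p_sym g in auto)
  from this close
  show ?thesis using eventually_ge_at_top[of 1]
  proof eventually_elim
    case (elim n)
    define S where "S = {x. emp_color n x = \<omega>n n}"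
    define p' where "p' = (\<lambda>a b. tilted_prob (p n a b) (g (a, b)))"
    define m where "m = measure_pmf.prob (colored_graph \<mu> (p n) n) S"
    have m: "m > 0" unfolding m_def S_def using pos[OF elim(3)] .
    have m': "measure_pmf.prob (colored_graph \<mu> p' n) S = m"
      unfolding m_def S_def prob_emp_color_colored_graph ..
    have ne: "set_pmf (colored_graph \<mu> q n) \<inter> S \<noteq> {}" if "measure_pmf.prob (colored_graph \<mu> q n) S = m" for q
      using that m by (metis measure_pmf_zero_iff less_irrefl)
    have P: "pmf (P n) x = (if x \<in> S then pmf (colored_graph \<mu> (p n) n) x / m else 0)" for x
      unfolding P_def S_def[symmetric] by (subst pmf_cond[OF ne]) (auto simp: m_def)
    have Q: "pmf (Q n) x = (if x \<in> S then pmf (colored_graph \<mu> p' n) x / m else 0)" for x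
      unfolding Q_def S_def[symmetric] p'_def[symmetric] by (subst pmf_cond[OF ne]) (auto simp: m')
    show ?case
    proof
      fix x
      define D where "D = 1 / 2 * total_gain g (emp_pair n x) (weighted_square C (\<omega>n n))"
      have D: "\<bar>D - L n x\<bar> \<le> \<epsilon> / 2"
        using elim(2) unfolding D_def L_def total_gain_eq G_def[symmetric] by (simp add: field_simps abs_le_iff abs_less_iff)
      show "exp (real n * (L n x - \<epsilon>)) * pmf (P n) x \<le> pmf (Q n) x \<and>
        pmf (Q n) x \<le> exp (real n * (L n x + \<epsilon>)) * pmf (P n) x"
      proof (cases "x \<in> S")
        case True
        have base: "exp (real n * (D - \<epsilon> / 2)) * pmf (colored_graph \<mu> (p n) n) x \<le> pmf (colored_graph \<mu> p' n) x"
          "pmf (colored_graph \<mu> p' n) x \<le> exp (real n * (D + \<epsilon> / 2)) * pmf (colored_graph \<mu> (p n) n) x"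
          using elim(1)[rule_format, of x] True by (auto simp: S_def D_def p'_def tilted_pmf_zero)
        have "L n x - \<epsilon> \<le> D - \<epsilon> / 2" "D + \<epsilon> / 2 \<le> L n x + \<epsilon>" using D by linarith+
        then have "exp (real n * (L n x - \<epsilon>)) \<le> exp (real n * (D - \<epsilon> / 2))"
          "exp (real n * (D + \<epsilon> / 2)) \<le> exp (real n * (L n x + \<epsilon>))"
          by (auto intro!: mult_left_mono)
        then have "exp (real n * (L n x - \<epsilon>)) * pmf (colored_graph \<mu> (p n) n) x \<le> pmf (colored_graph \<mu> p' n) x"
          "pmf (colored_graph \<mu> p' n) x \<le> exp (real n * (L n x + \<epsilon>)) * pmf (colored_graph \<mu> (p n) n) x"
          using base by (meson mult_right_mono order_trans pmf_nonneg)+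
        then show ?thesis using True m by (simp add: P Q divide_right_mono)
      qed (simp add: P Q)
    qed
  qed
qed

section \<open>The tilted families of the colored graph\<close>

lemma closed_pair_sublevel:
  shows "closed {z :: ('a::finite \<Rightarrow> real) \<times> ('a \<times> 'a \<Rightarrow> real).
    1 / 2 * (\<Sum>y\<in>UNIV. snd z y) - 1 / 2 * (\<Sum>y\<in>UNIV. weighted_square C (fst z) y * b y) \<le> r}"
  unfolding weighted_square_apply
  by (intro closed_Collect_le continuous_intros)

text \<open>Raising g by the constant one adds to the gain the total mass of \<open>\<pi>\<close>, minus a quantity bounded uniformly in
\<open>\<omega>\<close>.  So a bound on the difference bounds all coordinates.  This is the exponential
tightness of the number of edges.\<close>
lemma compact_pair_sublevel:
  fixes g :: "'a::finite \<times> 'a \<Rightarrow> real"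
  assumes C: "\<And>a b. 0 \<le> C a b" and A: "closed A" "A \<subseteq> prob_measures"
  shows "compact {z \<in> A \<times> sym_finite_measures.
    1 / 2 * total_gain (\<lambda>y. g y + 1) (snd z) (weighted_square C (fst z))
      - 1 / 2 * total_gain g (snd z) (weighted_square C (fst z)) \<le> r}" (is "compact ?K")
proof -
  define b where "b y = exp (g y + 1) - exp (g y)" for y
  have b0: "0 \<le> b y" for y by (simp add: b_def)
  define m where "m = 2 * r + (\<Sum>y\<in>UNIV. C (fst y) (snd y) * b y)"
  define D where "D z = 1 / 2 * (\<Sum>y\<in>UNIV. snd z y)
      - 1 / 2 * (\<Sum>y\<in>UNIV. weighted_square C (fst z) y * b y)" for z :: "('a \<Rightarrow> real) \<times> ('a \<times> 'a \<Rightarrow> real)"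
  have D: "1 / 2 * total_gain (\<lambda>y. g y + 1) (snd z) (weighted_square C (fst z))
      - 1 / 2 * total_gain g (snd z) (weighted_square C (fst z)) = D z" for z
    unfolding D_def b_def right_diff_distrib[symmetric] total_gain_shift ..
  have "?K = ({\<nu>. \<forall>x. \<nu> x \<in> {0..1}} \<times> {\<nu>. \<forall>x. \<nu> x \<in> {0..m}}) \<inter> ((A \<times> sym_finite_measures) \<inter> {z. D z \<le> r})"
  proof -
    have "\<omega> x \<in> {0..1} \<and> \<pi> y \<in> {0..m}"
      if \<omega>: "\<omega> \<in> A" and \<pi>: "\<pi> \<in> sym_finite_measures" and "D (\<omega>, \<pi>) \<le> r" for \<omega> \<pi> x y
    proof -
      have w: "\<omega> \<in> prob_measures" using A(2) \<omega> by auto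
      note w0 = prob_measures_nonneg[OF w] and w1 = prob_measures_le_1[OF w]
      have "\<pi> y \<le> (\<Sum>y\<in>UNIV. \<pi> y)"
        using sym_finite_measures_nonneg[OF \<pi>] by (intro member_le_sum) auto
      also have "\<dots> \<le> 2 * r + (\<Sum>y\<in>UNIV. weighted_square C \<omega> y * b y)"
        using that(3) unfolding D_def by simp
      also have "(\<Sum>y\<in>UNIV. weighted_square C \<omega> y * b y) \<le> (\<Sum>y\<in>UNIV. C (fst y) (snd y) * b y)"
      proof (intro sum_mono mult_right_mono b0)
        fix y :: "'a \<times> 'a"
        have "\<omega> (fst y) * \<omega> (snd y) \<le> 1" using mult_mono[OF w1 w1] w0 by fastforce
        then have "C (fst y) (snd y) * (\<omega> (fst y) * \<omega> (snd y)) \<le> C (fst y) (snd y) * 1"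
          by (intro mult_left_mono C)
        then show "weighted_square C \<omega> y \<le> C (fst y) (snd y)"
          by (simp add: weighted_square_apply mult.assoc)
      qed
      finally show ?thesis using w0 w1 sym_finite_measures_nonneg[OF \<pi>] by (simp add: m_def)
    qed
    then show ?thesis unfolding D by auto
  qed
  moreover have "closed ((A \<times> sym_finite_measures) \<inter> {z. D z \<le> r})"
    unfolding D_def by (intro closed_Int closed_Times A closed_sym_finite_measures closed_pair_sublevel)
  ultimately show ?thesis by (simp only: compact_Int_closed compact_Times compact_box)
qed

lemma ereal_half_mono: "ereal x \<le> h \<Longrightarrow> ereal (1 / 2 * x) \<le> ereal (1 / 2) * h"
  by (cases h) auto

lemma ereal_half_strict_mono: "ereal x < h \<Longrightarrow> ereal (1 / 2 * x) < ereal (1 / 2) * h"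
  by (cases h) auto

lemma tendsto_half: "((\<lambda>k. ereal (x k)) \<longlongrightarrow> h) F \<Longrightarrow> ((\<lambda>k. ereal (1 / 2 * x k)) \<longlongrightarrow> ereal (1 / 2) * h) F"
  using tendsto_cmult_ereal[of "ereal (1 / 2)" "\<lambda>k. ereal (x k)" h F] by simp

lemma weighted_square_nonneg:
  "(\<And>a b. 0 \<le> C a b) \<Longrightarrow> (\<And>a. 0 \<le> \<omega> a) \<Longrightarrow> 0 \<le> weighted_square C \<omega> y"
  by (simp add: weighted_square_apply)

lemma tilted_square_in_sym_finite_measures:
  assumes "\<And>a b. 0 \<le> C a b" "\<And>a b. C a b = C b a" "\<And>a. 0 \<le> \<omega> a" "\<And>a b. g (a, b) = g (b, a)"
  shows "(\<lambda>y. weighted_square C \<omega> y * exp (g y)) \<in> sym_finite_measures"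
proof -
  have "weighted_square C \<omega> (a, b) * exp (g (a, b)) = weighted_square C \<omega> (b, a) * exp (g (b, a))" for a b
    using assms(2)[of a b] assms(4)[of a b] by (simp add: weighted_square_apply)
  then show ?thesis
    using weighted_square_nonneg[of C \<omega>] assms by (simp add: sym_finite_measures_def)
qed

text \<open>Witnesses that the rate function is not constant.  The gain of the zero exponent is zero, and at any measure
other than W the entropy exceeds it strictly.\<close>
lemma gen_entropy_weighted_square:
  assumes C: "\<And>a b. 0 \<le> C a b" "\<And>a b. C a b = C b a" and \<omega>: "\<And>a. 0 \<le> \<omega> a"
  defines "W \<equiv> weighted_square C \<omega>"
  shows "W \<in> sym_finite_measures" "(\<lambda>y. W y + 1) \<in> sym_finite_measures"
    and "gen_entropy W W = 0" "0 < gen_entropy (\<lambda>y. W y + 1) W"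
proof -
  have W0: "0 \<le> W y" for y unfolding W_def by (rule weighted_square_nonneg) (use assms in auto)
  have sym: "W (a, b) = W (b, a)" for a b using C(2)[of a b] by (simp add: W_def weighted_square_apply)
  show "W \<in> sym_finite_measures" "(\<lambda>y. W y + 1) \<in> sym_finite_measures"
    using W0 sym by (auto simp: sym_finite_measures_def intro: add_nonneg_nonneg)
  have "entropy_term l l = 0" for l by (cases "l = 0") (auto simp: entropy_term_def)
  then show "gen_entropy W W = 0" by (simp add: gen_entropy_def zero_ereal_def)
  have "ereal (total_gain (\<lambda>_. 0) (\<lambda>y. W y + 1) W) < gen_entropy (\<lambda>y. W y + 1) W"
    by (rule total_gain_less_gen_entropy) (use W0 in \<open>auto simp: fun_eq_iff intro: add_nonneg_nonneg\<close>)
  then show "0 < gen_entropy (\<lambda>y. W y + 1) W" by (simp add: zero_ereal_def)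
qed

lemma conditional_tilted_family:
  fixes \<mu> :: "'a::finite pmf"
  assumes p_range: "\<And>n a b. n \<ge> 1 \<Longrightarrow> 0 \<le> p n a b \<and> p n a b \<le> 1"
    and p_sym: "\<And>n a b. n \<ge> 1 \<Longrightarrow> p n a b = p n b a"
    and p_lim: "\<And>a b. (\<lambda>n. real n * p n a b) \<longlonglongrightarrow> C a b"
    and C: "\<And>a b. 0 \<le> C a b" "\<And>a b. C a b = C b a"
    and \<omega>: "\<omega> \<in> prob_measures" and \<omega>n: "\<And>a. (\<lambda>n. \<omega>n n a) \<longlonglongrightarrow> \<omega> a"
    and pos: "\<And>n. n \<ge> 1 \<Longrightarrow> measure_pmf.prob (colored_graph \<mu> (p n) n) {x. emp_color n x = \<omega>n n} > 0"
  shows "tilted_family (weak_topology sym_finite_measures)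
    (\<lambda>n. cond_pmf (colored_graph \<mu> (p n) n) {x. emp_color n x = \<omega>n n}) emp_pair
    (\<lambda>\<pi>. ereal (1/2) * frak_H C \<pi> \<omega>)
    {g. \<forall>a b. g (a, b) = g (b, a)}
    (\<lambda>g \<pi>. 1 / 2 * total_gain g \<pi> (weighted_square C \<omega>))
    (\<lambda>g n. cond_pmf (colored_graph \<mu> (\<lambda>a b. tilted_prob (p n a b) (g (a, b))) n)
        {x. emp_color n x = \<omega>n n})
    (\<lambda>g y. weighted_square C \<omega> y * exp (g y))"
proof -
  define W where "W = weighted_square C \<omega>"
  note w0 = prob_measures_nonneg[OF \<omega>]
  have W0: "0 \<le> W y" for y unfolding W_def by (rule weighted_square_nonneg) (use C w0 in auto)
  show ?thesis
    unfolding weak_topology_eq_subtopology frak_H_eq_gen_entropy W_def[symmetric]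
  \<comment> \<open>the cases follow the order of the assumptions of the locale\<close>
  proof (unfold_locales, goal_cases)
    case (1 g)
    show ?case unfolding continuous_map_iff_continuous total_gain_eq
      by (intro continuous_intros continuous_on_subset[OF continuous_on_product_coordinates]) auto
  next
    case (2 n x)
    show ?case by (simp add: emp_pair_in_sym_finite_measures)
  next
    case (3 g \<epsilon>)
    then show ?case unfolding W_def
      by (intro conditional_graph_density p_lim \<omega>n) (use p_range p_sym pos in auto)
  next
    case 4
    show ?case by (rule bexI[of _ "\<lambda>_. 0"]) auto
  next
    case (5 g)
    have "compactin (top_of_set sym_finite_measures)
      {\<pi> \<in> topspace (top_of_set sym_finite_measures).
        1 / 2 * total_gain (\<lambda>y. g y + 1) \<pi> W - 1 / 2 * total_gain g \<pi> W \<le> r}" for r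
    proof -
      \<comment> \<open>the joint statement with the color measure confined to a single point\<close>
      let ?K = "{z \<in> {\<omega>} \<times> sym_finite_measures.
          1 / 2 * total_gain (\<lambda>y. g y + 1) (snd z) (weighted_square C (fst z))
        - 1 / 2 * total_gain g (snd z) (weighted_square C (fst z)) \<le> r}"
      have "closed {\<nu>. \<forall>a. \<nu> a = \<omega> a}"
        by (intro closed_Collect_all closed_Collect_eq continuous_on_const continuous_on_product_coordinates)
      moreover have "{\<nu>. \<forall>a. \<nu> a = \<omega> a} = {\<omega>}" by auto
      ultimately have "closed {\<omega>}" by simp
      then have "compact ?K" by (rule compact_pair_sublevel[OF C(1)]) (use \<omega> in auto)
      then have "compact (snd ` ?K)"
        by (rule compact_continuous_image[OF continuous_on_snd[OF continuous_on_id]])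
      moreover have "snd ` ?K = {\<pi> \<in> sym_finite_measures.
        1 / 2 * total_gain (\<lambda>y. g y + 1) \<pi> W - 1 / 2 * total_gain g \<pi> W \<le> r}"
        by (auto simp: W_def image_iff)
      ultimately show ?thesis by (simp add: compactin_subtopology)
    qed
    then show ?case using 5 by (intro bexI[of _ "\<lambda>y. g y + 1"]) auto
  next
    case (6 g \<pi>)
    then show ?case
      by (intro ereal_half_mono total_gain_le_gen_entropy W0 sym_finite_measures_nonneg) auto
  next
    case (7 g \<pi>)
    then show ?case
      by (intro ereal_half_strict_mono total_gain_less_gen_entropy W0 sym_finite_measures_nonneg) auto
  next
    case (8 \<pi>)
    then have \<pi>: "\<pi> \<in> sym_finite_measures" by simp
    show ?case
    proof (rule pair_sequence[where C = C and \<omega> = \<omega>, OF \<pi> w0 C, folded W_def])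
      fix g :: "nat \<Rightarrow> 'a \<times> 'a \<Rightarrow> real"
      assume g: "\<And>k a b. g k (a, b) = g k (b, a)"
        "(\<lambda>k. ereal (total_gain (g k) \<pi> W)) \<longlonglongrightarrow> gen_entropy \<pi> W"
        "\<And>\<omega>' y. gen_entropy \<pi> W < \<infinity> \<Longrightarrow> (\<And>a. (\<lambda>k. \<omega>' k a) \<longlonglongrightarrow> \<omega> a) \<Longrightarrow>
          (\<lambda>k. weighted_square C (\<omega>' k) y * exp (g k y)) \<longlonglongrightarrow> \<pi> y"
        "\<And>\<omega>'. gen_entropy \<pi> W < \<infinity> \<Longrightarrow> (\<And>a. (\<lambda>k. \<omega>' k a) \<longlonglongrightarrow> \<omega> a) \<Longrightarrow>
          (\<lambda>k. ereal (total_gain (g k) (\<lambda>y. weighted_square C (\<omega>' k) y * exp (g k y))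
            (weighted_square C (\<omega>' k)))) \<longlonglongrightarrow> gen_entropy \<pi> W"
      have "limitin (top_of_set sym_finite_measures) (\<lambda>k y. W y * exp (g k y)) \<pi> sequentially \<and>
          (\<lambda>k. ereal (1 / 2 * total_gain (g k) (\<lambda>y. W y * exp (g k y)) W)) \<longlonglongrightarrow> ereal (1 / 2) * gen_entropy \<pi> W"
        if "gen_entropy \<pi> W < \<infinity>"
      proof
        have "(\<lambda>y. W y * exp (g k y)) \<in> sym_finite_measures" for k
          unfolding W_def by (rule tilted_square_in_sym_finite_measures) (use C w0 g(1) in auto)
        moreover have "((\<lambda>k y. W y * exp (g k y)) \<longlongrightarrow> \<pi>) sequentially"
          unfolding tendsto_fun_iff using g(3)[OF that, of "\<lambda>_. \<omega>"] by (simp add: W_def)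
        ultimately show "limitin (top_of_set sym_finite_measures) (\<lambda>k y. W y * exp (g k y)) \<pi> sequentially"
          using \<pi> by (simp add: limitin_subtopology)
        show "(\<lambda>k. ereal (1 / 2 * total_gain (g k) (\<lambda>y. W y * exp (g k y)) W)) \<longlonglongrightarrow> ereal (1 / 2) * gen_entropy \<pi> W"
          using g(4)[OF that, of "\<lambda>_. \<omega>"] by (intro tendsto_half) (simp add: W_def)
      qed
      moreover have "gen_entropy \<pi> W < \<infinity>" if "ereal (1 / 2) * gen_entropy \<pi> W < \<infinity>"
        using that by (cases "gen_entropy \<pi> W") auto
      ultimately show ?case using g(1) tendsto_half[OF g(2)] by (intro exI[of _ g]) auto
    qed
  next
    case 9
    note ne = gen_entropy_weighted_square[where C = C and \<omega> = \<omega>, OF C w0, folded W_def]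
    have "ereal (1 / 2) * gen_entropy W W \<noteq> ereal (1 / 2) * gen_entropy (\<lambda>y. W y + 1) W"
      using ne(3,4) ereal_half_strict_mono[of 0 "gen_entropy (\<lambda>y. W y + 1) W"] by auto
    then show ?case using ne(1,2) by auto
  qed
qed

text \<open>Only normalized f are admitted, so that \<open>\<mu> exp f\<close> is a color law and the gain of f is the plain
integral of f against \<open>\<omega>\<close>.\<close>
lemma joint_tilted_family:
  fixes \<mu> :: "'a::finite pmf"
  assumes p_range: "\<And>n a b. n \<ge> 1 \<Longrightarrow> 0 \<le> p n a b \<and> p n a b \<le> 1"
    and p_sym: "\<And>n a b. n \<ge> 1 \<Longrightarrow> p n a b = p n b a"
    and p_lim: "\<And>a b. (\<lambda>n. real n * p n a b) \<longlonglongrightarrow> C a b"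
    and C: "\<And>a b. 0 \<le> C a b" "\<And>a b. C a b = C b a"
  shows "tilted_family
    (prod_topology (weak_topology prob_measures) (weak_topology sym_finite_measures))
    (\<lambda>n. colored_graph \<mu> (p n) n)
    (\<lambda>n x. (emp_color n x, emp_pair n x))
    (\<lambda>(\<omega>, \<pi>). rel_entropy \<omega> (pmf \<mu>) + ereal (1/2) * frak_H C \<pi> \<omega>)
    {(f, g). (\<Sum>a\<in>UNIV. pmf \<mu> a * exp (f a)) = 1 \<and> (\<forall>a b. g (a, b) = g (b, a))}
    (\<lambda>(f, g) (\<omega>, \<pi>). total_gain f \<omega> (pmf \<mu>) + 1 / 2 * total_gain g \<pi> (weighted_square C \<omega>))
    (\<lambda>(f, g) n. colored_graph (tilted_pmf \<mu> f) (\<lambda>a b. tilted_prob (p n a b) (g (a, b))) n)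
    (\<lambda>(f, g). let \<omega> = (\<lambda>a. pmf \<mu> a * exp (f a))
       in (\<omega>, \<lambda>y. weighted_square C \<omega> y * exp (g y)))"
proof -
  have mu1: "(\<Sum>a\<in>UNIV. pmf \<mu> a) = 1" by (rule sum_pmf_eq_1) auto
  have mu: "pmf \<mu> \<in> prob_measures" using mu1 by (simp add: prob_measures_def)
  have relH: "rel_entropy \<omega> (pmf \<mu>) = gen_entropy \<omega> (pmf \<mu>)" if "\<omega> \<in> prob_measures" for \<omega>
    using that mu1 by (intro rel_entropy_eq_gen_entropy) (simp add: prob_measures_def)
  have W0: "0 \<le> weighted_square C \<omega> y" if "\<omega> \<in> prob_measures" for \<omega> y
    by (rule weighted_square_nonneg) (use C that prob_measures_nonneg in auto)
  have tilt_prob: "(\<lambda>a. pmf \<mu> a * exp (f a)) \<in> prob_measures"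
    if "(\<Sum>a\<in>UNIV. pmf \<mu> a * exp (f a)) = 1" for f
    using that by (simp add: prob_measures_def)
  have top: "prod_topology (weak_topology prob_measures) (weak_topology sym_finite_measures)
      = top_of_set (prob_measures \<times> (sym_finite_measures :: ('a \<times> 'a \<Rightarrow> real) set))"
    by (simp add: weak_topology_eq_subtopology prod_topology_subtopology_eu)
  have addless: "ereal (x + y) < a + b" if "ereal x < a" "ereal y \<le> b" for x y and a b :: ereal
    using that by (cases a; cases b) auto
  have addless': "ereal (x + y) < a + b" if "ereal x \<le> a" "ereal y < b" for x y and a b :: ereal
    using that by (cases a; cases b) auto
  show ?thesis
    unfolding top frak_H_eq_gen_entropy
  \<comment> \<open>the cases follow the order of the assumptions of the locale\<close>
  proof (unfold_locales, goal_cases)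
    case (1 s)
    obtain f g where s: "s = (f, g)" by (cases s)
    show ?case unfolding continuous_map_iff_continuous total_gain_eq s prod.case split_beta weighted_square_apply
      by (intro continuous_intros)
  next
    case (2 n x)
    then show ?case by (simp add: emp_pair_in_sym_finite_measures emp_color_in_prob_measures)
  next
    case (3 s \<epsilon>)
    obtain f g where s: "s = (f, g)" by (cases s)
    show ?case unfolding s prod.case
      by (intro graph_density p_lim) (use 3 p_range p_sym in \<open>auto simp: s\<close>)
  next
    case 4
    \<comment> \<open>the trivial tilt\<close>
    show ?case by (rule bexI[of _ "(\<lambda>_. 0, \<lambda>_. 0)"]) (auto simp: mu1)
  next
    case (5 s)
    obtain f g where s: "s = (f, g)" by (cases s)
    let ?L = "\<lambda>(f, g) (\<omega>, \<pi>). total_gain f \<omega> (pmf \<mu>) + 1 / 2 * total_gain g \<pi> (weighted_square C \<omega>)"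
    have "compactin (top_of_set (prob_measures \<times> sym_finite_measures))
      {z \<in> topspace (top_of_set (prob_measures \<times> sym_finite_measures)).
        ?L (f, \<lambda>y. g y + 1) z - ?L s z \<le> r}" for r
    proof -
      have "{z \<in> topspace (top_of_set (prob_measures \<times> sym_finite_measures)).
          ?L (f, \<lambda>y. g y + 1) z - ?L s z \<le> r}
        = {z \<in> prob_measures \<times> sym_finite_measures.
          1 / 2 * total_gain (\<lambda>y. g y + 1) (snd z) (weighted_square C (fst z))
        - 1 / 2 * total_gain g (snd z) (weighted_square C (fst z)) \<le> r}"
        by (auto simp: s)
      then show ?thesis
        using compact_pair_sublevel[where A = prob_measures and g = g and r = r and C = C,
            OF C(1) closed_prob_measures order_refl]
        by (auto simp: compactin_subtopology)
    qed
    then show ?case using 5 by (intro bexI[of _ "(f, \<lambda>y. g y + 1)"]) (auto simp: s)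
  next
    case (6 s z)
    obtain f g \<omega> \<pi> where s: "s = (f, g)" "z = (\<omega>, \<pi>)" by (cases s; cases z)
    have \<omega>: "\<omega> \<in> prob_measures" and \<pi>: "\<pi> \<in> sym_finite_measures" using 6 by (auto simp: s)
    show ?case unfolding s prod.case relH[OF \<omega>] plus_ereal.simps(1)[symmetric]
      by (intro add_mono ereal_half_mono total_gain_le_gen_entropy W0 \<omega>
          sym_finite_measures_nonneg[OF \<pi>] prob_measures_nonneg[OF \<omega>] pmf_nonneg)
  next
    case (7 s z)
    obtain f g \<omega> \<pi> where s: "s = (f, g)" "z = (\<omega>, \<pi>)" by (cases s; cases z)
    have \<omega>: "\<omega> \<in> prob_measures" and \<pi>: "\<pi> \<in> sym_finite_measures" using 7 by (auto simp: s)
    note nonneg = W0[OF \<omega>] sym_finite_measures_nonneg[OF \<pi>] prob_measures_nonneg[OF \<omega>] pmf_nonneg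
    show ?case
    proof (cases "\<omega> = (\<lambda>a. pmf \<mu> a * exp (f a))")
      case True
      then have "\<pi> \<noteq> (\<lambda>y. weighted_square C \<omega> y * exp (g y))" using 7 by (auto simp: s Let_def)
      then show ?thesis unfolding s prod.case relH[OF \<omega>]
        by (intro addless' ereal_half_strict_mono total_gain_le_gen_entropy total_gain_less_gen_entropy nonneg)
    next
      case False
      then show ?thesis unfolding s prod.case relH[OF \<omega>]
        by (intro addless ereal_half_mono total_gain_le_gen_entropy total_gain_less_gen_entropy nonneg)
    qed
  next
    case (8 z)
    obtain \<omega> \<pi> where z: "z = (\<omega>, \<pi>)" by (cases z)
    have \<omega>: "\<omega> \<in> prob_measures" and \<pi>: "\<pi> \<in> sym_finite_measures" using 8 by (auto simp: z)
    note w0 = prob_measures_nonneg[OF \<omega>]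
    define H where "H = gen_entropy \<omega> (pmf \<mu>)"
    define K where "K = gen_entropy \<pi> (weighted_square C \<omega>)"
    have HK: "0 \<le> H" "0 \<le> K"
      unfolding H_def K_def using w0 W0[OF \<omega>] sym_finite_measures_nonneg[OF \<pi>]
      by (auto intro!: gen_entropy_nonneg)
    show ?case
    proof (rule color_sequence[OF \<omega>, of \<mu>, folded H_def])
      fix f :: "nat \<Rightarrow> 'a \<Rightarrow> real"
      assume f: "\<And>k. (\<Sum>a\<in>UNIV. pmf \<mu> a * exp (f k a)) = 1"
        "(\<lambda>k. ereal (total_gain (f k) \<omega> (pmf \<mu>))) \<longlonglongrightarrow> H"
        "\<And>a. H < \<infinity> \<Longrightarrow> (\<lambda>k. pmf \<mu> a * exp (f k a)) \<longlonglongrightarrow> \<omega> a"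
        "H < \<infinity> \<Longrightarrow> (\<lambda>k. ereal (total_gain (f k) (\<lambda>a. pmf \<mu> a * exp (f k a)) (pmf \<mu>))) \<longlonglongrightarrow> H"
      show ?case
      proof (rule pair_sequence[where C = C and \<omega> = \<omega>, OF \<pi> w0 C, folded K_def])
        fix g :: "nat \<Rightarrow> 'a \<times> 'a \<Rightarrow> real"
        assume g: "\<And>k a b. g k (a, b) = g k (b, a)"
          "(\<lambda>k. ereal (total_gain (g k) \<pi> (weighted_square C \<omega>))) \<longlonglongrightarrow> K"
          "\<And>\<omega>' y. K < \<infinity> \<Longrightarrow> (\<And>a. (\<lambda>k. \<omega>' k a) \<longlonglongrightarrow> \<omega> a) \<Longrightarrow>
            (\<lambda>k. weighted_square C (\<omega>' k) y * exp (g k y)) \<longlonglongrightarrow> \<pi> y"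
          "\<And>\<omega>'. K < \<infinity> \<Longrightarrow> (\<And>a. (\<lambda>k. \<omega>' k a) \<longlonglongrightarrow> \<omega> a) \<Longrightarrow>
            (\<lambda>k. ereal (total_gain (g k) (\<lambda>y. weighted_square C (\<omega>' k) y * exp (g k y))
              (weighted_square C (\<omega>' k)))) \<longlonglongrightarrow> K"
        have add: "(\<lambda>k. ereal (x k + 1 / 2 * y k)) \<longlonglongrightarrow> H + ereal (1 / 2) * K"
          if "(\<lambda>k. ereal (x k)) \<longlonglongrightarrow> H" "(\<lambda>k. ereal (y k)) \<longlonglongrightarrow> K" for x y
        proof -
          have "(\<lambda>k. ereal (x k) + ereal (1 / 2 * y k)) \<longlonglongrightarrow> H + ereal (1 / 2) * K"
            by (rule tendsto_add_ereal_nonneg) (use HK that tendsto_half in auto)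
          then show ?thesis by simp
        qed
        define w where "w k a = pmf \<mu> a * exp (f k a)" for k a
        have "limitin (top_of_set (prob_measures \<times> sym_finite_measures))
              (\<lambda>k. (w k, \<lambda>y. weighted_square C (w k) y * exp (g k y))) (\<omega>, \<pi>) sequentially \<and>
            (\<lambda>k. ereal (total_gain (f k) (w k) (pmf \<mu>) + 1 / 2 * total_gain (g k)
              (\<lambda>y. weighted_square C (w k) y * exp (g k y)) (weighted_square C (w k))))
              \<longlonglongrightarrow> H + ereal (1 / 2) * K"
          if fin: "H < \<infinity>" "K < \<infinity>"
        proof
          have wP: "w k \<in> prob_measures" for k unfolding w_def[abs_def] by (rule tilt_prob[OF f(1)])
          have "(\<lambda>y. weighted_square C (w k) y * exp (g k y)) \<in> sym_finite_measures" for k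
            by (rule tilted_square_in_sym_finite_measures) (use C prob_measures_nonneg[OF wP] g(1) in auto)
          moreover have w_lim: "(\<lambda>k. w k a) \<longlonglongrightarrow> \<omega> a" for a unfolding w_def by (rule f(3)[OF fin(1)])
          have "((\<lambda>k. (w k, \<lambda>y. weighted_square C (w k) y * exp (g k y))) \<longlongrightarrow> (\<omega>, \<pi>)) sequentially"
            using w_lim g(3)[OF fin(2) w_lim] by (intro tendsto_Pair) (auto simp: tendsto_fun_iff)
          ultimately show "limitin (top_of_set (prob_measures \<times> sym_finite_measures))
              (\<lambda>k. (w k, \<lambda>y. weighted_square C (w k) y * exp (g k y))) (\<omega>, \<pi>) sequentially"
            using \<omega> \<pi> wP by (simp add: limitin_subtopology)
          show "(\<lambda>k. ereal (total_gain (f k) (w k) (pmf \<mu>) + 1 / 2 * total_gain (g k)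
              (\<lambda>y. weighted_square C (w k) y * exp (g k y)) (weighted_square C (w k))))
              \<longlonglongrightarrow> H + ereal (1 / 2) * K"
            by (rule add[OF _ g(4)[OF fin(2) w_lim]]) (use f(4)[OF fin(1)] in \<open>simp add: w_def[abs_def]\<close>)
        qed
        moreover have "H < \<infinity> \<and> K < \<infinity>" if "H + ereal (1 / 2) * K < \<infinity>"
          using that HK by (cases H; cases K) auto
        ultimately show ?case
          unfolding z prod.case relH[OF \<omega>] H_def[symmetric] K_def[symmetric]
          by (intro exI[of _ "\<lambda>k. (f k, g k)"])
            (use f(1) g(1) add[OF f(2) g(2)] in \<open>auto simp: Let_def w_def[abs_def]\<close>)
      qed
    qed
  next
    case 9
    define W where "W = weighted_square C (pmf \<mu>)"
    note ne = gen_entropy_weighted_square[where C = C and \<omega> = "pmf \<mu>", OF C pmf_nonneg, folded W_def]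
    have H0: "gen_entropy (pmf \<mu>) (pmf \<mu>) = 0"
      by (auto simp: gen_entropy_def entropy_term_def zero_ereal_def intro!: sum.neutral)
    have "ereal (1 / 2) * gen_entropy W W \<noteq> ereal (1 / 2) * gen_entropy (\<lambda>y. W y + 1) W"
      using ne(3,4) ereal_half_strict_mono[of 0 "gen_entropy (\<lambda>y. W y + 1) W"] by auto
    then show ?case
      using ne(1,2) mu
      by (intro bexI[of _ "(pmf \<mu>, W)"] bexI[of _ "(pmf \<mu>, \<lambda>y. W y + 1)"])
        (auto simp: relH[OF mu] H0 W_def)
  qed
qed

theorem theorem2p3:
  fixes \<mu> :: "'a::finite pmf"
    and p :: "nat \<Rightarrow> 'a \<Rightarrow> 'a \<Rightarrow> real"
    and C :: "'a \<Rightarrow> 'a \<Rightarrow> real"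
  assumes p_range: "\<And>n a b. n \<ge> 1 \<Longrightarrow> 0 \<le> p n a b \<and> p n a b \<le> 1"
    and p_sym: "\<And>n a b. n \<ge> 1 \<Longrightarrow> p n a b = p n b a"
    and p_lim: "\<And>a b. (\<lambda>n. real n * p n a b) \<longlonglongrightarrow> C a b"
    and C_nonneg: "\<And>a b. 0 \<le> C a b"
    and C_sym: "\<And>a b. C a b = C b a"
    and C_nonzero: "\<exists>a b. C a b \<noteq> 0"
  shows
    "(\<forall>(\<omega>n :: nat \<Rightarrow> 'a \<Rightarrow> real) \<omega>.
        (\<forall>n\<ge>1. \<omega>n n \<in> lattice_measures n) \<longrightarrow>
        limitin (weak_topology prob_measures) \<omega>n \<omega> sequentially \<longrightarrow>
        (\<forall>n\<ge>1. measure_pmf.prob (colored_graph \<mu> (p n) n) {g. emp_color n g = \<omega>n n} > 0) \<longrightarrow>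
        good_rate_function (weak_topology sym_finite_measures)
          (\<lambda>\<pi>. ereal (1/2) * frak_H C \<pi> \<omega>) \<and>
        satisfies_LDP (weak_topology sym_finite_measures)
          (\<lambda>n. measure_pmf (cond_pmf (colored_graph \<mu> (p n) n) {g. emp_color n g = \<omega>n n}))
          emp_pair
          (\<lambda>\<pi>. ereal (1/2) * frak_H C \<pi> \<omega>))
     \<and>
     (good_rate_function
        (prod_topology (weak_topology prob_measures) (weak_topology sym_finite_measures))
        (\<lambda>(\<omega>, \<pi>). rel_entropy \<omega> (pmf \<mu>) + ereal (1/2) * frak_H C \<pi> \<omega>) \<and>
      satisfies_LDP
        (prod_topology (weak_topology prob_measures) (weak_topology sym_finite_measures))
        (\<lambda>n. measure_pmf (colored_graph \<mu> (p n) n))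
        (\<lambda>n g. (emp_color n g, emp_pair n g))
        (\<lambda>(\<omega>, \<pi>). rel_entropy \<omega> (pmf \<mu>) + ereal (1/2) * frak_H C \<pi> \<omega>))"
proof -
  have conditional: "good_rate_function (weak_topology sym_finite_measures)
          (\<lambda>\<pi>. ereal (1/2) * frak_H C \<pi> \<omega>) \<and>
        satisfies_LDP (weak_topology sym_finite_measures)
          (\<lambda>n. measure_pmf (cond_pmf (colored_graph \<mu> (p n) n) {g. emp_color n g = \<omega>n n}))
          emp_pair (\<lambda>\<pi>. ereal (1/2) * frak_H C \<pi> \<omega>)"
    if lim: "limitin (weak_topology prob_measures) \<omega>n \<omega> sequentially"
      and pos: "\<forall>n\<ge>1. measure_pmf.prob (colored_graph \<mu> (p n) n) {g. emp_color n g = \<omega>n n} > 0"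
    for \<omega>n :: "nat \<Rightarrow> 'a \<Rightarrow> real" and \<omega>
  proof -
    from lim have \<omega>: "\<omega> \<in> prob_measures" "\<And>a. (\<lambda>n. \<omega>n n a) \<longlonglongrightarrow> \<omega> a"
      by (auto simp: weak_topology_eq_subtopology limitin_subtopology tendsto_fun_iff)
    interpret tilted_family "weak_topology sym_finite_measures"
      "\<lambda>n. cond_pmf (colored_graph \<mu> (p n) n) {x. emp_color n x = \<omega>n n}" emp_pair
      "\<lambda>\<pi>. ereal (1/2) * frak_H C \<pi> \<omega>"
      "{g. \<forall>a b. g (a, b) = g (b, a)}"
      "\<lambda>g \<pi>. 1 / 2 * total_gain g \<pi> (weighted_square C \<omega>)"
      "\<lambda>g n. cond_pmf (colored_graph \<mu> (\<lambda>a b. tilted_prob (p n a b) (g (a, b))) n)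
          {x. emp_color n x = \<omega>n n}"
      "\<lambda>g y. weighted_square C \<omega> y * exp (g y)"
      by (rule conditional_tilted_family) (use assms \<omega> pos in auto)
    show ?thesis
      using good_rate LDP by blast
  qed
  note joint = joint_tilted_family[where \<mu> = \<mu> and p = p and C = C]
  have "good_rate_function
        (prod_topology (weak_topology prob_measures) (weak_topology sym_finite_measures))
        (\<lambda>(\<omega>, \<pi>). rel_entropy \<omega> (pmf \<mu>) + ereal (1/2) * frak_H C \<pi> \<omega>)"
    by (rule tilted_family.good_rate[OF joint]) (use assms in auto)
  moreover have "satisfies_LDP
        (prod_topology (weak_topology prob_measures) (weak_topology sym_finite_measures))
        (\<lambda>n. measure_pmf (colored_graph \<mu> (p n) n))
        (\<lambda>n g. (emp_color n g, emp_pair n g))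
        (\<lambda>(\<omega>, \<pi>). rel_entropy \<omega> (pmf \<mu>) + ereal (1/2) * frak_H C \<pi> \<omega>)"
    by (rule tilted_family.LDP[OF joint]) (use assms in auto)
  ultimately show ?thesis using conditional by blast
qed

end
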